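(* Let $A\in\mathbb{Z}^{d\times n}$ have rank $d$ with columns lying in an affine hyperplane of $\mathbb{Q}^d$ not containing the origin, let $\beta\in\mathbb{C}^d$, let $w\in\mathbb{R}^n$ be a generic weight vector, and let $v$ be a fake exponent of $H_A(\beta)$ with respect to $w$, with $I_0=\operatorname{nsupp}(v)=\{i_1,\ldots,i_k\}$ and $V=[n]\setminus I_0$. Let $L_1,\ldots,L_k,\ell_1,\ldots,\ell_{d-k}$ be linear forms in $\theta_V=(\theta_j)_{j\in V}$ such that $\langle A\theta\rangle$ is generated by $\theta_{i_1}-L_1(\theta_V),\ldots,\theta_{i_k}-L_k(\theta_V),\ell_1(\theta_V),\ldots,\ell_{d-k}(\theta_V)$, and regard $\ell_1,\ldots,\ell_{d-k}$ as elements of $\mathbb{C}[\operatorname{link}_v]$ via $\theta_j\mapsto x_j$. Assume that $\mathcal{S}_w(v)$ contains a top-dimensional standard pair and that $\mathbb{C}[\operatorname{link}_v]$ is Cohen--Macaulay. Then $$\ell_1,\ldots,\ell_{d-|I_0|}$$ form a regular sequence on $\mathbb{C}[\operatorname{link}_v]$.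
   Context: Notation: $\mathbb{N}=\{0,1,2,\ldots\}$, $[n]=\{1,\ldots,n\}$. The toric ideal is $I_A=\langle\partial^u-\partial^{u'}\mid Au=Au',\ u,u'\in\mathbb{N}^n\rangle\subseteq\mathbb{C}[\partial_1,\ldots,\partial_n]$. $\operatorname{in}_w(I_A)$ is the ideal generated by the $w$-initial forms (sums of terms of maximal $w$-weight) of elements of $I_A$; "$w$ generic" means in particular that $\operatorname{in}_w(I_A)$ is a monomial ideal. Let $D=\mathbb{C}\langle x_1,\ldots,x_n,\partial_1,\ldots,\partial_n\rangle$ be the Weyl algebra and $\vartheta_j=x_j\partial_j$. $H_A(\beta)$ is the left ideal of $D$ generated by $I_A$ and the Euler operators $\sum_j a_{ij}\vartheta_j-\beta_i$. The fake indicial ideal is $(D\cdot\operatorname{in}_w(I_A)\cap\mathbb{C}[\vartheta])+\langle A\vartheta-\beta\rangle\subseteq\mathbb{C}[\vartheta]$; a zero $v\in\mathbb{C}^n$ of it is called a fake exponent of $H_A(\beta)$ with respect to $w$. $\operatorname{nsupp}(z)=\{j\in[n]\mid z_j\in\mathbb{Z}_{<0}\}$ for $z\in\mathbb{C}^n$. A standard pair of a monomial ideal $M\subseteq\mathbb{C}[\partial]$ is a pair $(a,\sigma)$, $a\in\mathbb{N}^n$, $\sigma\subseteq[n]$, such that (i) $a_i=0$ for $i\in\sigma$; (ii) $\partial^a\prod_{j\in\sigma}\partial_j^{b_j}\notin M$ for all $b_j\in\mathbb{N}$; (iii) for every $\ell\notin\sigma$ there are $b_j\in\mathbb{N}$ ($j\in\sigma\cup\{\ell\}$)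 with $\partial^a\prod_{j\in\sigma\cup\{\ell\}}\partial_j^{b_j}\in M$. $\mathcal{S}(M)$ is the set of standard pairs. A standard pair of $\operatorname{in}_w(I_A)$ is top-dimensional if $|\sigma|=d$. Put $\mathcal{S}_w(v)=\{(a,\sigma)\in\mathcal{S}(\operatorname{in}_w(I_A))\mid v_j=a_j\text{ for every }j\notin\sigma\}$. (Known criterion: $v$ is a fake exponent iff $Av=\beta$ and $\mathcal{S}_w(v)\neq\emptyset$.) $\Delta_w(v)=\{\tau\subseteq[n]\mid\tau\subseteq\sigma\text{ for some }(a,\sigma)\in\mathcal{S}_w(v)\}$, and $\operatorname{link}_v=\{\tau\in\Delta_w(v)\mid\tau\cap I_0=\emptyset,\ \tau\cup I_0\in\Delta_w(v)\}$, regarded as a simplicial complex on the vertex set $V$ (some elements of $V$ may be nonfaces). For a simplicial complex $\Delta$ on $V$, $I_\Delta=\langle\prod_{i\in\tau}x_i\mid\tau\subseteq V,\ \tau\notin\Delta\rangle$ and $\mathbb{C}[\Delta]=\mathbb{C}[x_i\mid i\in V]/I_\Delta$. $\langle A\theta\rangle=\langle\sum_j a_{ij}\theta_j\mid i=1,\ldots,d\rangle\subseteq\mathbb{C}[\theta_1,\ldots,\theta_n]$. Linear forms $L_p,\ell_q$ as in the claim exist by row reduction. *)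

theory Defs
  imports
    "HOL-Analysis.Cartesian_Space"
    "HOL-Library.Poly_Mapping"
    "HOL-Library.Extended_Nat"
    "HOL-Algebra.QuotRing"
    "HOL-Algebra.Ring_Divisibility"
begin

section \<open>Polynomial rings\<close>

text \<open>Polynomials with complex coefficients in variables indexed by \<^typ>\<open>'n\<close>, as finitely
  supported functions from exponent vectors to coefficients; multiplication is convolution.\<close>

type_synonym 'n expo = "'n \<Rightarrow>\<^sub>0 nat"
type_synonym 'n mpol = "'n expo \<Rightarrow>\<^sub>0 complex"

definition monom :: "'n expo \<Rightarrow> 'n mpol" where
  "monom u = Poly_Mapping.single u 1"

definition Var :: "'n \<Rightarrow> 'n mpol" where
  "Var j = monom (Poly_Mapping.single j 1)"

definition Const :: "complex \<Rightarrow> 'n mpol" where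
  "Const c = Poly_Mapping.single 0 c"

definition eval_mpol :: "('n::finite) mpol \<Rightarrow> complex ^ 'n \<Rightarrow> complex" where
  "eval_mpol p z = (\<Sum>u\<in>Poly_Mapping.keys p.
     Poly_Mapping.lookup p u * (\<Prod>j\<in>UNIV. (z $ j) ^ Poly_Mapping.lookup u j))"

definition mpol_ring :: "'n set \<Rightarrow> 'n mpol ring" where
  "mpol_ring V =
     \<lparr>carrier = {p. \<forall>u\<in>Poly_Mapping.keys p. Poly_Mapping.keys u \<subseteq> V},
      mult = (*), one = 1, zero = 0, add = (+)\<rparr>"

definition linear_form :: "('n::finite) set \<Rightarrow> 'n mpol \<Rightarrow> bool" where
  "linear_form V p \<longleftrightarrow> (\<exists>c. p = (\<Sum>j\<in>V. Const (c j) * Var j))"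

definition monomial_ideal :: "'n mpol set \<Rightarrow> bool" where
  "monomial_ideal M \<longleftrightarrow> (\<exists>U. M = Idl\<^bsub>mpol_ring UNIV\<^esub> (monom ` U))"

section \<open>Toric ideals and initial ideals\<close>

definition toric_ideal :: "int ^ 'n ^ 'd \<Rightarrow> ('n::finite) mpol set" where
  "toric_ideal A = Idl\<^bsub>mpol_ring UNIV\<^esub>
     {monom u - monom u' | u u'.
        \<forall>i. (\<Sum>j\<in>UNIV. A $ i $ j * int (Poly_Mapping.lookup u j))
          = (\<Sum>j\<in>UNIV. A $ i $ j * int (Poly_Mapping.lookup u' j))}"

definition weight :: "real ^ 'n \<Rightarrow> ('n::finite) expo \<Rightarrow> real" where
  "weight w u = (\<Sum>j\<in>UNIV. w $ j * real (Poly_Mapping.lookup u j))"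

definition initial_form :: "real ^ 'n \<Rightarrow> ('n::finite) mpol \<Rightarrow> 'n mpol" where
  "initial_form w p =
     (\<Sum>u\<in>{u \<in> Poly_Mapping.keys p. \<forall>u'\<in>Poly_Mapping.keys p. weight w u' \<le> weight w u}.
        Poly_Mapping.single u (Poly_Mapping.lookup p u))"

definition initial_ideal :: "real ^ 'n \<Rightarrow> ('n::finite) mpol set \<Rightarrow> 'n mpol set" where
  "initial_ideal w I = Idl\<^bsub>mpol_ring UNIV\<^esub> (initial_form w ` I)"

definition generic_weight :: "int ^ 'n ^ 'd \<Rightarrow> real ^ ('n::finite) \<Rightarrow> bool" where
  "generic_weight A w \<longleftrightarrow> monomial_ideal (initial_ideal w (toric_ideal A))"

definition homogeneous_config :: "int ^ ('n::finite) ^ ('d::finite) \<Rightarrow> bool" where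
  "homogeneous_config A \<longleftrightarrow>
     (\<exists>(h :: rat ^ 'd) c. h \<noteq> 0 \<and> c \<noteq> 0 \<and>
        (\<forall>j. (\<Sum>i\<in>UNIV. h $ i * rat_of_int (A $ i $ j)) = c))"

section \<open>The Weyl algebra and fake exponents\<close>

text \<open>In characteristic 0 the Weyl algebra is the algebra of operators on the polynomial
  ring generated by the multiplications by the variables and the partial derivatives; the
  product is composition.\<close>

type_synonym 'n oper = "'n mpol \<Rightarrow> 'n mpol"

definition op_x :: "'n \<Rightarrow> 'n oper" where
  "op_x j f = Var j * f"

definition op_d :: "'n \<Rightarrow> 'n oper" where
  "op_d j f = (\<Sum>u\<in>Poly_Mapping.keys f.
     Poly_Mapping.single (u - Poly_Mapping.single j 1)
       (of_nat (Poly_Mapping.lookup u j) * Poly_Mapping.lookup f u))"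

definition op_theta :: "'n \<Rightarrow> 'n oper" where
  "op_theta j = op_x j \<circ> op_d j"

inductive_set weyl_algebra :: "'n oper set" where
  scalar: "(\<lambda>f. Const c * f) \<in> weyl_algebra"
| x: "op_x j \<in> weyl_algebra"
| d: "op_d j \<in> weyl_algebra"
| add: "P \<in> weyl_algebra \<Longrightarrow> Q \<in> weyl_algebra \<Longrightarrow> (\<lambda>f. P f + Q f) \<in> weyl_algebra"
| mult: "P \<in> weyl_algebra \<Longrightarrow> Q \<in> weyl_algebra \<Longrightarrow> P \<circ> Q \<in> weyl_algebra"

inductive_set weyl_left_ideal :: "'n oper set \<Rightarrow> 'n oper set" for S where
  zero: "(\<lambda>f. 0) \<in> weyl_left_ideal S"
| add: "P \<in> weyl_algebra \<Longrightarrow> Q \<in> S \<Longrightarrow> R \<in> weyl_left_ideal S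
    \<Longrightarrow> (\<lambda>f. P (Q f) + R f) \<in> weyl_left_ideal S"

text \<open>Substitution of operators \<open>T j\<close> for the variables of a polynomial. The fold is
  meaningful only if the \<open>T j\<close> commute pairwise, as the \<^const>\<open>op_d\<close> do, and also the
  \<^const>\<open>op_theta\<close>.\<close>

definition op_subst :: "('n::finite \<Rightarrow> 'n oper) \<Rightarrow> 'n mpol \<Rightarrow> 'n oper" where
  "op_subst T p f = (\<Sum>u\<in>Poly_Mapping.keys p.
     Const (Poly_Mapping.lookup p u) *
       Finite_Set.fold (\<lambda>j g. (T j ^^ Poly_Mapping.lookup u j) g) f UNIV)"

definition euler_ideal :: "int ^ 'n ^ 'd \<Rightarrow> complex ^ 'd \<Rightarrow> ('n::finite) mpol set" where
  "euler_ideal A \<beta> = Idl\<^bsub>mpol_ring UNIV\<^esub>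
     (range (\<lambda>i. (\<Sum>j\<in>UNIV. Const (of_int (A $ i $ j)) * Var j) - Const (\<beta> $ i)))"

definition fake_indicial_ideal ::
    "int ^ 'n ^ 'd \<Rightarrow> complex ^ 'd \<Rightarrow> real ^ 'n \<Rightarrow> ('n::finite) mpol set" where
  "fake_indicial_ideal A \<beta> w =
     {p. op_subst op_theta p
           \<in> weyl_left_ideal (op_subst op_d ` initial_ideal w (toric_ideal A))}
     <+>\<^bsub>mpol_ring UNIV\<^esub> euler_ideal A \<beta>"

definition fake_exponent ::
    "int ^ 'n ^ 'd \<Rightarrow> complex ^ 'd \<Rightarrow> real ^ 'n \<Rightarrow> complex ^ ('n::finite) \<Rightarrow> bool" where
  "fake_exponent A \<beta> w v \<longleftrightarrow> (\<forall>p\<in>fake_indicial_ideal A \<beta> w. eval_mpol p v = 0)"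

definition nsupp :: "complex ^ ('n::finite) \<Rightarrow> 'n set" where
  "nsupp z = {j. \<exists>m::int. m < 0 \<and> z $ j = of_int m}"

section \<open>Standard pairs and the associated complexes\<close>

definition standard_pairs :: "('n::finite) mpol set \<Rightarrow> ('n expo \<times> 'n set) set" where
  "standard_pairs M = {(a, \<sigma>).
     (\<forall>i\<in>\<sigma>. Poly_Mapping.lookup a i = 0) \<and>
     (\<forall>b::'n \<Rightarrow> nat. monom a * (\<Prod>j\<in>\<sigma>. Var j ^ b j) \<notin> M) \<and>
     (\<forall>l. l \<notin> \<sigma> \<longrightarrow>
        (\<exists>b::'n \<Rightarrow> nat. monom a * (\<Prod>j\<in>\<sigma> \<union> {l}. Var j ^ b j) \<in> M))}"

definition standard_pairs_at ::
    "int ^ 'n ^ 'd \<Rightarrow> real ^ 'n \<Rightarrow> complex ^ 'n \<Rightarrow> (('n::finite) expo \<times> 'n set) set" where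
  "standard_pairs_at A w v =
     {(a, \<sigma>) \<in> standard_pairs (initial_ideal w (toric_ideal A)).
        \<forall>j. j \<notin> \<sigma> \<longrightarrow> v $ j = of_nat (Poly_Mapping.lookup a j)}"

definition Delta_complex ::
    "int ^ 'n ^ 'd \<Rightarrow> real ^ 'n \<Rightarrow> complex ^ 'n \<Rightarrow> ('n::finite) set set" where
  "Delta_complex A w v = {\<tau>. \<exists>(a, \<sigma>)\<in>standard_pairs_at A w v. \<tau> \<subseteq> \<sigma>}"

definition link_complex ::
    "int ^ 'n ^ 'd \<Rightarrow> real ^ 'n \<Rightarrow> complex ^ 'n \<Rightarrow> ('n::finite) set set" where
  "link_complex A w v =
     {\<tau> \<in> Delta_complex A w v. \<tau> \<inter> nsupp v = {} \<and> \<tau> \<union> nsupp v \<in> Delta_complex A w v}"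

definition SR_ideal :: "'n set \<Rightarrow> 'n set set \<Rightarrow> 'n mpol set" where
  "SR_ideal V \<Delta> = Idl\<^bsub>mpol_ring V\<^esub> {\<Prod>i\<in>\<tau>. Var i | \<tau>. \<tau> \<subseteq> V \<and> \<tau> \<notin> \<Delta>}"

definition SR_ring :: "'n set \<Rightarrow> 'n set set \<Rightarrow> 'n mpol set ring" where
  "SR_ring V \<Delta> = mpol_ring V Quot SR_ideal V \<Delta>"

definition SR_class :: "'n set \<Rightarrow> 'n set set \<Rightarrow> 'n mpol \<Rightarrow> 'n mpol set" where
  "SR_class V \<Delta> p = SR_ideal V \<Delta> +>\<^bsub>mpol_ring V\<^esub> p"

section \<open>Regular sequences and Cohen--Macaulay rings\<close>

definition regular_sequence :: "('a, 'b) ring_scheme \<Rightarrow> 'a list \<Rightarrow> bool" where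
  "regular_sequence R fs \<longleftrightarrow>
     set fs \<subseteq> carrier R \<and>
     (\<forall>i<length fs. \<forall>g\<in>carrier R.
        fs ! i \<otimes>\<^bsub>R\<^esub> g \<in> Idl\<^bsub>R\<^esub> (set (take i fs)) \<longrightarrow> g \<in> Idl\<^bsub>R\<^esub> (set (take i fs))) \<and>
     Idl\<^bsub>R\<^esub> (set fs) \<noteq> carrier R"

definition ideal_depth :: "('a, 'b) ring_scheme \<Rightarrow> 'a set \<Rightarrow> enat" where
  "ideal_depth R I = Sup {enat (length fs) | fs. regular_sequence R fs \<and> set fs \<subseteq> I}"

definition prime_height :: "('a, 'b) ring_scheme \<Rightarrow> 'a set \<Rightarrow> enat" where
  "prime_height R P = Sup {enat m | m. \<exists>Q::nat \<Rightarrow> 'a set.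
     (\<forall>i\<le>m. primeideal (Q i) R) \<and> (\<forall>i<m. Q i \<subset> Q (Suc i)) \<and> Q m = P}"

text \<open>Eisenbud's definition: a Noetherian ring is Cohen--Macaulay if depth and codimension
  agree for every maximal ideal. These are the depth and the dimension of the localization
  at that ideal.\<close>

definition cohen_macaulay :: "('a, 'b) ring_scheme \<Rightarrow> bool" where
  "cohen_macaulay R \<longleftrightarrow> cring R \<and> noetherian_ring R \<and>
     (\<forall>m. maximalideal m R \<longrightarrow> ideal_depth R m = prime_height R m)"

end

theory Submission
  imports Defs
begin

text \<open>A dependency among the columns of \<open>A\<close> over a standard pair \<open>(a, \<sigma>)\<close> would give a binomial of
  the toric ideal in the variables of \<open>\<sigma>\<close>, hence a monomial of the initial ideal in these
  variables; so the columns over \<open>\<sigma>\<close> are independent. Eliminating the variables of \<open>I\<^sub>0\<close>, the forms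
  \<open>\<ell>\<^sub>q\<close> restrict to a spanning set of the linear forms on every face of the link, and therefore
  all variables are nilpotent modulo the \<open>\<ell>\<^sub>q\<close>. The facet coming from the top-dimensional standard
  pair yields a chain of \<open>d - k\<close> primes below the irrelevant maximal ideal, so by the
  Cohen--Macaulay property that ideal contains a regular sequence of length \<open>d - k\<close>. Dividing by
  this sequence step by step shows that the first Koszul homology of the \<open>\<ell>\<^sub>q\<close> vanishes, and for
  forms of positive degree this means that they are a regular sequence, by Nakayama.\<close>

section \<open>Ideals of commutative rings given by type classes\<close>

text \<open>The Cohen--Macaulay property supplies a regular sequence of which only the length and
  the position inside the irrelevant ideal are known: its members need be neither homogeneous nor
  related to the forms. The Koszul complex of the forms compares the two sequences. If
  \<open>f\<close> is a nonzerodivisor modulo \<open>J\<close>, vanishing of the homology modulo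
  \<open>J\<close> and \<open>f\<close> in one degree makes \<open>f\<close> injective on the
  homology modulo \<open>J\<close> one degree lower. The forms annihilate that homology, so
  \<open>f\<close>, being nilpotent modulo them, acts nilpotently there too, and the homology is
  zero. Each element thus lowers the range of vanishing by one degree, and \<open>d - k\<close> of
  them bring it from the degrees above \<open>d - k\<close>, where there are no chains, down to
  degree 1. Only a lower bound for the height enters; no dimension of a quotient by the forms is
  computed. Homogeneity of the forms is needed at the end: vanishing for the whole list only says
  that one form is a nonzerodivisor modulo the others, and truncation by degree passes the vanishing
  on to shorter lists.\<close>

abbreviation is_ideal :: "'a::comm_ring_1 set \<Rightarrow> bool" where
  "is_ideal \<equiv> Modules.module.subspace (*)"

abbreviation ideal_span :: "'a::comm_ring_1 set \<Rightarrow> 'a set" where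
  "ideal_span \<equiv> Modules.module.span (*)"

lemma module_times: "Modules.module ((*) :: 'a::comm_ring_1 \<Rightarrow> 'a \<Rightarrow> 'a)"
  by unfold_locales (simp_all add: algebra_simps)

lemmas is_idealI = module.subspaceI [OF module_times]
lemmas is_ideal_0 = module.subspace_0 [OF module_times]
lemmas is_ideal_add = module.subspace_add [OF module_times]
lemmas is_ideal_mult = module.subspace_scale [OF module_times]
lemmas is_ideal_uminus = module.subspace_neg [OF module_times]
lemmas is_ideal_diff = module.subspace_diff [OF module_times]
lemmas is_ideal_sum = module.subspace_sum [OF module_times]
lemmas is_ideal_span = module.subspace_span [OF module_times]
lemmas ideal_span_base = module.span_base [OF module_times]
lemmas ideal_span_mono = module.span_mono [OF module_times]
lemmas ideal_span_minimal = module.span_minimal [OF module_times]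
lemmas ideal_span_insert = module.span_breakdown_eq [OF module_times]
lemmas ideal_span_eq = module.span_eq_iff [OF module_times]

lemma is_ideal_mult': "is_ideal J \<Longrightarrow> x \<in> J \<Longrightarrow> x * c \<in> J"
  by (metis is_ideal_mult mult.commute)

lemma is_ideal_add_cancel: "is_ideal J \<Longrightarrow> x \<in> J \<Longrightarrow> x + y \<in> J \<longleftrightarrow> y \<in> J"
  by (metis add_diff_cancel_left' is_ideal_add is_ideal_diff)

lemma is_ideal_diff_cong: "is_ideal J \<Longrightarrow> x - y \<in> J \<Longrightarrow> x \<in> J \<longleftrightarrow> y \<in> J"
  by (metis diff_add_cancel is_ideal_add_cancel)

lemma is_ideal_radical:
  fixes I :: "'a::comm_ring_1 set"
  assumes I: "is_ideal I"
  shows "is_ideal {p. \<exists>N. p ^ N \<in> I}"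
proof (rule is_idealI, goal_cases)
  case 1
  have "0 ^ 1 \<in> I" using is_ideal_0[OF I] by simp
  then show ?case by blast
next
  case (2 x y)
  then obtain M N where M: "x ^ M \<in> I" and N: "y ^ N \<in> I" by blast
  \<comment> \<open>In each binomial term either \<open>x\<close> has exponent at least
    \<open>M\<close> or \<open>y\<close> has exponent at least \<open>N\<close>.\<close>
  have "of_nat ((M + N) choose k) * x ^ k * y ^ (M + N - k) \<in> I" for k
  proof (cases "M \<le> k")
    case True
    then have "x ^ k = x ^ M * x ^ (k - M)" by (simp flip: power_add)
    then show ?thesis using M I
      by (metis (no_types, lifting) is_ideal_mult' is_ideal_mult)
  next
    case False
    then have "y ^ (M + N - k) = y ^ N * y ^ (M - k)" by (simp add: add.commute flip: power_add)
    then show ?thesis using N I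
      by (metis (no_types, lifting) is_ideal_mult' is_ideal_mult)
  qed
  then have "(x + y) ^ (M + N) \<in> I"
    unfolding binomial_ring by (intro is_ideal_sum[OF I]) auto
  then show ?case by blast
next
  case (3 c x)
  then show ?case using is_ideal_mult[OF I] by (auto simp: power_mult_distrib)
qed

section \<open>Koszul complexes\<close>

text \<open>A Koszul chain on \<open>l\<^sub>1, \<dots>, l\<^sub>r\<close> assigns a ring element to each subset of \<open>{1..r}\<close>, coded by
  its characteristic bit list; the complex is the iterated mapping cone of the multiplications
  by the \<open>l\<^sub>i\<close>.\<close>

fun koszul_d :: "'a::comm_ring_1 list \<Rightarrow> (bool list \<Rightarrow> 'a) \<Rightarrow> bool list \<Rightarrow> 'a" where
  "koszul_d (l # ls) c (b # bs) =
     (if b then - koszul_d ls (\<lambda>t. c (True # t)) bs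
      else koszul_d ls (\<lambda>t. c (False # t)) bs + l * c (True # bs))"
| "koszul_d _ _ _ = 0"

text \<open>This is exterior multiplication by the \<open>i\<close>-th basis vector, counted from 0,
  just as \<open>koszul_d\<close> is contraction with the functional whose values are the entries of
  the list. The minus sign comes from moving one basis vector past another.\<close>

fun koszul_h :: "nat \<Rightarrow> (bool list \<Rightarrow> 'a::comm_ring_1) \<Rightarrow> bool list \<Rightarrow> 'a" where
  "koszul_h 0 c (b # bs) = (if b then c (False # bs) else 0)"
| "koszul_h (Suc i) c (b # bs) =
     (if b then - koszul_h i (\<lambda>t. c (True # t)) bs else koszul_h i (\<lambda>t. c (False # t)) bs)"
| "koszul_h _ _ [] = 0"

text \<open>These lists index the basis of the \<open>j\<close>-th exterior power. Chains are
  functions on all bit lists, so each condition on a chain has to name the cells that it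
  concerns.\<close>

definition cells :: "nat \<Rightarrow> nat \<Rightarrow> bool list set" where
  "cells r j = {bs. length bs = r \<and> count_list bs True = j}"

lemma Nil_cells: "[] \<in> cells r j \<longleftrightarrow> r = 0 \<and> j = 0"
  by (auto simp: cells_def)

lemma Cons_cells:
  "b # bs \<in> cells r j \<longleftrightarrow> (\<exists>r'. r = Suc r' \<and>
     (if b then (\<exists>j'. j = Suc j' \<and> bs \<in> cells r' j') else bs \<in> cells r' j))"
  by (cases r; cases j) (auto simp: cells_def)

lemma cells_empty: "r < j \<Longrightarrow> cells r j = {}"
  using count_le_length[of _ True] by (auto simp: cells_def not_le[symmetric])

lemma finite_cells: "finite (cells r j)"
  using finite_lists_length_eq[of "UNIV :: bool set" r]
  by (rule finite_subset[rotated]) (auto simp: cells_def)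

lemma koszul_d_add: "koszul_d ls (\<lambda>t. c t + e t) bs = koszul_d ls c bs + koszul_d ls e bs"
  by (induction ls c bs arbitrary: e rule: koszul_d.induct)
     (auto simp: distrib_left)

lemma koszul_d_mult: "koszul_d ls (\<lambda>t. a * c t) bs = a * koszul_d ls c bs"
  by (induction ls c bs rule: koszul_d.induct) (simp_all add: algebra_simps)

lemma koszul_d_uminus: "koszul_d ls (\<lambda>t. - c t) bs = - koszul_d ls c bs"
  using koszul_d_mult[of ls "-1" c bs] by simp

lemma koszul_d_diff: "koszul_d ls (\<lambda>t. c t - e t) bs = koszul_d ls c bs - koszul_d ls e bs"
  using koszul_d_add[of ls c "\<lambda>t. - e t" bs] by (simp add: koszul_d_uminus)

lemma koszul_d_zero: "koszul_d ls (\<lambda>t. 0) bs = 0"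
  using koszul_d_mult[of ls 0 "\<lambda>_. 0" bs] by simp

lemma koszul_d_d: "koszul_d ls (koszul_d ls c) bs = 0"
  by (induction ls c bs rule: koszul_d.induct)
     (simp_all add: koszul_d_add koszul_d_mult koszul_d_uminus)

lemma koszul_h_add: "koszul_h i (\<lambda>t. c t + e t) bs = koszul_h i c bs + koszul_h i e bs"
  by (induction i c bs arbitrary: e rule: koszul_h.induct) auto

lemma koszul_h_mult: "koszul_h i (\<lambda>t. a * c t) bs = a * koszul_h i c bs"
  by (induction i c bs rule: koszul_h.induct) (simp_all add: algebra_simps)

lemma koszul_h_uminus: "koszul_h i (\<lambda>t. - c t) bs = - koszul_h i c bs"
  using koszul_h_mult[of i "-1" c bs] by simp

text \<open>Contraction and exterior multiplication satisfy a Cartan formula, so every entry of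
  \<open>ls\<close> acts on the complex as zero up to homotopy.\<close>

lemma koszul_homotopy:
  assumes "i < length ls" "length bs = length ls"
  shows "koszul_d ls (koszul_h i c) bs + koszul_h i (koszul_d ls c) bs = ls ! i * c bs"
  using assms
proof (induction ls arbitrary: i c bs)
  case Nil
  then show ?case by simp
next
  case (Cons l ls)
  then obtain b bs' where bs: "bs = b # bs'" "length bs' = length ls" by (cases bs) auto
  show ?case
  proof (cases i)
    case 0
    then show ?thesis using bs by (simp add: koszul_d_zero)
  next
    case (Suc i')
    have IH: "koszul_d ls (koszul_h i' e) bs' + koszul_h i' (koszul_d ls e) bs' = ls ! i' * e bs'"
      for e using Cons.IH[of i' bs'] Cons.prems bs Suc by simp
    show ?thesis
      using Suc bs IH[of "\<lambda>t. c (b # t)"]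
      by (cases b)
         (simp_all add: koszul_d_uminus koszul_h_uminus koszul_h_add koszul_h_mult algebra_simps)
  qed
qed

text \<open>The value on a cell of degree \<open>j\<close> is computed from values in degree
  \<open>j + 1\<close> alone, so congruences modulo \<open>J\<close> have to be known in that degree
  only.\<close>

lemma koszul_d_in_ideal:
  assumes "is_ideal J" "\<forall>bs\<in>cells (length ls) (Suc j). q bs \<in> J" "bs \<in> cells (length ls) j"
  shows "koszul_d ls q bs \<in> J"
  using assms(2,3)
proof (induction ls arbitrary: q bs j)
  case Nil
  then show ?case using is_ideal_0[OF assms(1)] by simp
next
  case (Cons l ls)
  then obtain b bs' where bs: "bs = b # bs'" by (cases bs) (auto simp: cells_def)
  note J = assms(1) and q = Cons.prems(1)
  show ?case
  proof (cases b)
    case True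
    with bs Cons.prems(2) obtain j' where j': "j = Suc j'" "bs' \<in> cells (length ls) j'"
      by (auto simp: Cons_cells)
    have "koszul_d ls (\<lambda>t. q (True # t)) bs' \<in> J"
      using q j' by (intro Cons.IH[of j']) (auto simp: Cons_cells)
    then show ?thesis using True bs is_ideal_uminus[OF J] by simp
  next
    case False
    with bs Cons.prems(2) have bs': "bs' \<in> cells (length ls) j" by (auto simp: Cons_cells)
    have "koszul_d ls (\<lambda>t. q (False # t)) bs' \<in> J"
      using q bs' by (intro Cons.IH[of j]) (auto simp: Cons_cells)
    moreover have "q (True # bs') \<in> J" using q bs' by (auto simp: Cons_cells)
    ultimately show ?thesis
      using False bs is_ideal_add[OF J] is_ideal_mult[OF J] by simp
  qed
qed

lemma koszul_h_in_ideal: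
  assumes "is_ideal J" "\<forall>bs\<in>cells r j. q bs \<in> J" "bs \<in> cells r (Suc j)"
  shows "koszul_h i q bs \<in> J"
  using assms(2,3)
proof (induction i q bs arbitrary: r j rule: koszul_h.induct)
  case (1 c b bs)
  then show ?case using is_ideal_0[OF assms(1)] by (auto simp: Cons_cells)
next
  case (2 i c b bs)
  note J = assms(1)
  from "2.prems" obtain r' where r: "r = Suc r'" by (auto simp: Cons_cells)
  show ?case
  proof (cases b)
    case True
    with "2.prems" r have bs: "bs \<in> cells r' j" by (auto simp: Cons_cells)
    show ?thesis
    proof (cases j)
      case 0
      \<comment> \<open>The only \<open>True\<close> of the cell is its head, whereas exterior
        multiplication by a later basis vector writes only to cells that are \<open>True\<close> at
        that later position.\<close>
      have "koszul_h i e bs = 0" if "count_list bs True = 0" for e :: "bool list \<Rightarrow> 'a"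
        using that by (induction i e bs rule: koszul_h.induct) (auto split: if_splits)
      then show ?thesis using True bs 0 is_ideal_0[OF J] by (simp add: cells_def)
    next
      case (Suc j')
      have "koszul_h i (\<lambda>t. c (True # t)) bs \<in> J"
        using "2.IH"(1)[OF True, of r' j'] "2.prems"(1) r Suc bs by (auto simp: Cons_cells)
      then show ?thesis using True is_ideal_uminus[OF J] by simp
    qed
  next
    case False
    have "koszul_h i (\<lambda>t. c (False # t)) bs \<in> J"
      using "2.IH"(2)[OF False, of r' j] "2.prems" r False by (auto simp: Cons_cells)
    then show ?thesis using False by simp
  qed
next
  case (3 i c)
  then show ?case by (simp add: Nil_cells)
qed

text \<open>Vanishing of the Koszul homology of \<open>ls\<close> on the quotient by \<open>J\<close> in degree \<open>j + 1\<close>.\<close>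

definition koszul_exact :: "nat \<Rightarrow> 'a::comm_ring_1 list \<Rightarrow> 'a set \<Rightarrow> bool" where
  "koszul_exact j ls J \<longleftrightarrow> (\<forall>c. (\<forall>bs\<in>cells (length ls) j. koszul_d ls c bs \<in> J) \<longrightarrow>
     (\<exists>e. \<forall>bs\<in>cells (length ls) (Suc j). c bs - koszul_d ls e bs \<in> J))"

text \<open>The multipliers that turn the cycle \<open>c\<close> into a boundary modulo
  \<open>J\<close> form an ideal. It contains \<open>J\<close> trivially and the entries of
  \<open>ls\<close> by the homotopy formula.\<close>

lemma koszul_homology_annihilated:
  assumes J: "is_ideal J" and p: "p \<in> ideal_span (J \<union> set ls)"
    and c: "\<forall>bs\<in>cells (length ls) j. koszul_d ls c bs \<in> J"
  shows "\<exists>e. \<forall>bs\<in>cells (length ls) (Suc j). p * c bs - koszul_d ls e bs \<in> J"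
proof -
  let ?B = "cells (length ls) (Suc j)"
  let ?K = "{p. \<exists>e. \<forall>bs\<in>?B. p * c bs - koszul_d ls e bs \<in> J}"
  have "is_ideal ?K"
  proof (rule is_idealI, goal_cases)
    case 1
    have "\<forall>bs\<in>?B. 0 * c bs - koszul_d ls (\<lambda>_. 0) bs \<in> J"
      by (simp add: koszul_d_zero is_ideal_0[OF J])
    then show ?case by blast
  next
    case (2 x y)
    then obtain e f where e: "\<forall>bs\<in>?B. x * c bs - koszul_d ls e bs \<in> J"
      and f: "\<forall>bs\<in>?B. y * c bs - koszul_d ls f bs \<in> J" by auto
    have "(x + y) * c bs - koszul_d ls (\<lambda>t. e t + f t) bs \<in> J" if "bs \<in> ?B" for bs
      using is_ideal_add[OF J e[rule_format, OF that] f[rule_format, OF that]]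
      by (simp add: koszul_d_add algebra_simps)
    then show ?case by blast
  next
    case (3 a x)
    then obtain e where e: "\<forall>bs\<in>?B. x * c bs - koszul_d ls e bs \<in> J" by auto
    have "(a * x) * c bs - koszul_d ls (\<lambda>t. a * e t) bs \<in> J" if "bs \<in> ?B" for bs
      using is_ideal_mult[OF J e[rule_format, OF that], of a]
      by (simp add: koszul_d_mult algebra_simps)
    then show ?case by blast
  qed
  moreover have "J \<subseteq> ?K"
  proof
    fix q assume "q \<in> J"
    then have "\<forall>bs\<in>?B. q * c bs - koszul_d ls (\<lambda>_. 0) bs \<in> J"
      by (simp add: koszul_d_zero is_ideal_mult'[OF J])
    then show "q \<in> ?K" by blast
  qed
  moreover have "set ls \<subseteq> ?K"
  proof
    fix q assume "q \<in> set ls"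
    then obtain i where i: "i < length ls" "q = ls ! i" by (auto simp: in_set_conv_nth)
    have "q * c bs - koszul_d ls (koszul_h i c) bs \<in> J" if bs: "bs \<in> ?B" for bs
    proof -
      have "length bs = length ls" using bs by (simp add: cells_def)
      from koszul_homotopy[OF i(1) this, of c]
      have "q * c bs - koszul_d ls (koszul_h i c) bs = koszul_h i (koszul_d ls c) bs"
        by (simp add: i algebra_simps)
      also have "\<dots> \<in> J" by (rule koszul_h_in_ideal[OF J c bs])
      finally show ?thesis .
    qed
    then show "q \<in> ?K" by blast
  qed
  ultimately show ?thesis using ideal_span_minimal[of "J \<union> set ls" ?K] p by blast
qed

text \<open>The connecting homomorphism: \<open>f\<close> acts injectively on the homology, and nilpotently.\<close>

lemma koszul_exact_nonzerodivisor:
  assumes J: "is_ideal J" and nzd: "\<And>g. f * g \<in> J \<Longrightarrow> g \<in> J"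
    and pow: "f ^ N \<in> ideal_span (J \<union> set ls)"
    and ex: "koszul_exact (Suc j) ls (ideal_span (insert f J))"
  shows "koszul_exact j ls J"
  unfolding koszul_exact_def
proof (intro allI impI)
  let ?B = "cells (length ls)"
  fix c assume c: "\<forall>bs\<in>?B j. koszul_d ls c bs \<in> J"
  \<comment> \<open>Injectivity of \<open>f\<close> on homology: if \<open>f * c = d e\<close>
    modulo \<open>J\<close>, then \<open>e\<close> is a cycle modulo \<open>J\<close> and
    \<open>f\<close>. Exactness one degree up gives \<open>e = d g + f * h\<close> modulo
    \<open>J\<close>, and applying \<open>d\<close> leaves \<open>f * (c - d h)\<close> in
    \<open>J\<close>.\<close>
  have step: "\<exists>e. \<forall>bs\<in>?B (Suc j). c bs - koszul_d ls e bs \<in> J"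
    if e: "\<forall>bs\<in>?B (Suc j). f * c bs - koszul_d ls e bs \<in> J" for c e
  proof -
    have "koszul_d ls e bs \<in> ideal_span (insert f J)" if "bs \<in> ?B (Suc j)" for bs
    proof -
      have "f * c bs - koszul_d ls e bs \<in> ideal_span (insert f J)"
        using e that by (intro ideal_span_base) auto
      moreover have "f * c bs \<in> ideal_span (insert f J)"
        by (intro is_ideal_mult'[OF is_ideal_span] ideal_span_base) auto
      ultimately show ?thesis using is_ideal_diff_cong[OF is_ideal_span] by blast
    qed
    with ex obtain g where
      "\<forall>bs\<in>?B (Suc (Suc j)). e bs - koszul_d ls g bs \<in> ideal_span (insert f J)"
      unfolding koszul_exact_def by blast
    then have "\<forall>bs\<in>?B (Suc (Suc j)). \<exists>k. e bs - koszul_d ls g bs - k * f \<in> J"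
      using ideal_span_eq[of J] J by (simp add: ideal_span_insert)
    then obtain h where
      h: "\<forall>bs\<in>?B (Suc (Suc j)). e bs - koszul_d ls g bs - h bs * f \<in> J" by metis
    have "c bs - koszul_d ls h bs \<in> J" if bs: "bs \<in> ?B (Suc j)" for bs
    proof -
      have "koszul_d ls (\<lambda>t. e t - koszul_d ls g t - f * h t) bs \<in> J"
        using h bs by (intro koszul_d_in_ideal[OF J]) (auto simp: mult.commute)
      then have "koszul_d ls e bs - f * koszul_d ls h bs \<in> J"
        by (simp add: koszul_d_diff koszul_d_d koszul_d_mult)
      from is_ideal_add[OF J this e[rule_format, OF bs]]
      have "f * (c bs - koszul_d ls h bs) \<in> J" by (simp add: algebra_simps)
      then show ?thesis by (rule nzd)
    qed
    then show ?thesis by blast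
  qed
  \<comment> \<open>The power \<open>f ^ N\<close> kills the class of \<open>c\<close>; injectivity
    strips off its factors one at a time.\<close>
  have "\<exists>e. \<forall>bs\<in>?B (Suc j). f ^ M * c bs - koszul_d ls e bs \<in> J
    \<Longrightarrow> \<exists>e. \<forall>bs\<in>?B (Suc j). c bs - koszul_d ls e bs \<in> J" for M
  proof (induction M)
    case 0
    then show ?case by simp
  next
    case (Suc M)
    then show ?case using step[of "\<lambda>t. f ^ M * c t"] by (simp add: mult.assoc) blast
  qed
  then show "\<exists>e. \<forall>bs\<in>?B (Suc j). c bs - koszul_d ls e bs \<in> J"
    using koszul_homology_annihilated[OF J pow c] by blast
qed

section \<open>Regular sequences and vanishing of the first Koszul homology\<close>

definition regular_mod :: "'a::comm_ring_1 set \<Rightarrow> 'a list \<Rightarrow> bool" where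
  "regular_mod J fs \<longleftrightarrow> (\<forall>i<length fs. \<forall>g.
     fs ! i * g \<in> ideal_span (J \<union> set (take i fs)) \<longrightarrow> g \<in> ideal_span (J \<union> set (take i fs)))"

lemma regular_mod_Cons:
  assumes "is_ideal J" "regular_mod J (f # fs)"
  shows "f * g \<in> J \<Longrightarrow> g \<in> J" "regular_mod (ideal_span (insert f J)) fs"
proof -
  have J: "ideal_span J = J" using assms(1) by (simp add: ideal_span_eq)
  show "f * g \<in> J \<Longrightarrow> g \<in> J"
    using assms(2)[unfolded regular_mod_def, rule_format, of 0] J by simp
  have "ideal_span (ideal_span (insert f J) \<union> set (take i fs))
      = ideal_span (J \<union> set (take (Suc i) (f # fs)))" for i
  proof
    show "ideal_span (ideal_span (insert f J) \<union> set (take i fs))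
      \<subseteq> ideal_span (J \<union> set (take (Suc i) (f # fs)))"
      using ideal_span_mono[of "insert f J" "J \<union> set (take (Suc i) (f # fs))"]
      by (intro ideal_span_minimal is_ideal_span Un_least)
         (auto intro: ideal_span_base)
    show "ideal_span (J \<union> set (take (Suc i) (f # fs)))
      \<subseteq> ideal_span (ideal_span (insert f J) \<union> set (take i fs))"
      by (intro ideal_span_mono) (auto intro: ideal_span_base)
  qed
  then show "regular_mod (ideal_span (insert f J)) fs"
    using assms(2) unfolding regular_mod_def
    by (metis Suc_less_eq length_Cons nth_Cons_Suc)
qed

text \<open>Each element of \<open>fs\<close> is traded for one homological degree. Once
  \<open>fs\<close> is used up, \<open>length ls \<le> j\<close>, and there are no cells of degree
  \<open>Suc j\<close> left to check.\<close>

lemma koszul_exact_if_regular: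
  assumes "is_ideal J" "regular_mod J fs" "length ls \<le> j + length fs"
    and "\<And>f. f \<in> set fs \<Longrightarrow> \<exists>N. f ^ N \<in> ideal_span (J \<union> set ls)"
  shows "koszul_exact j ls J"
  using assms
proof (induction fs arbitrary: J j)
  case Nil
  then show ?case by (auto simp: koszul_exact_def cells_empty)
next
  case (Cons f fs)
  obtain N where N: "f ^ N \<in> ideal_span (J \<union> set ls)" using Cons.prems(4)[of f] by auto
  have "ideal_span (J \<union> set ls) \<subseteq> ideal_span (ideal_span (insert f J) \<union> set ls)"
    by (intro ideal_span_mono) (auto intro: ideal_span_base)
  then have "koszul_exact (Suc j) ls (ideal_span (insert f J))"
    using Cons.prems regular_mod_Cons(2)[OF Cons.prems(1,2)]
    by (intro Cons.IH is_ideal_span) (auto, blast)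
  with N show ?case
    using koszul_exact_nonzerodivisor regular_mod_Cons(1)[OF Cons.prems(1,2)] Cons.prems(1)
    by blast
qed

text \<open>The all-\<open>False\<close> list is the only cell of degree 0, and there the
  differential is the combination of the entries of \<open>ls\<close> with the degree 1 coefficients
  of \<open>c\<close>.\<close>

lemma ideal_span_koszul_d:
  assumes J: "is_ideal J" and p: "p \<in> ideal_span (J \<union> set ls)"
  obtains c where "\<forall>bs\<in>cells (length ls) 0. p - koszul_d ls c bs \<in> J"
proof -
  have "\<exists>e. \<forall>bs\<in>cells (length ls) 0. p - koszul_d ls e bs \<in> J"
    using p
  proof (induction ls arbitrary: p)
    case Nil
    then show ?case using ideal_span_eq J by auto
  next
    case (Cons l ls)
    then obtain k where "p - k * l \<in> ideal_span (J \<union> set ls)" by (auto simp: ideal_span_insert)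
    with Cons.IH obtain e where
      e: "\<forall>bs\<in>cells (length ls) 0. p - k * l - koszul_d ls e bs \<in> J" by blast
    have "p - koszul_d (l # ls) (\<lambda>t. if hd t then k else e (tl t)) bs \<in> J"
      if "bs \<in> cells (length (l # ls)) 0" for bs
      using that e by (cases bs) (auto simp: cells_def algebra_simps split: if_splits)
    then show ?case by blast
  qed
  then show ?thesis using that by blast
qed

lemma koszul_d_in_ideal_span: "koszul_d ls c bs \<in> ideal_span (J \<union> set ls)"
proof (induction ls c bs rule: koszul_d.induct)
  case (1 l ls c b bs)
  have sub: "ideal_span (J \<union> set ls) \<subseteq> ideal_span (J \<union> set (l # ls))"
    by (intro ideal_span_mono) auto
  have "l * c (True # bs) \<in> ideal_span (J \<union> set (l # ls))"
    by (intro is_ideal_mult'[OF is_ideal_span] ideal_span_base) auto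
  with 1 sub show ?case
    by (auto intro!: is_ideal_uminus[OF is_ideal_span] is_ideal_add[OF is_ideal_span])
qed (auto intro: is_ideal_0[OF is_ideal_span])

text \<open>A representation of \<open>l * g\<close> through \<open>ls\<close> is a cycle of degree
  1 with coefficient \<open>g\<close> at \<open>l\<close>. In a boundary, the coefficient at
  \<open>l\<close> is itself a combination of the entries of \<open>ls\<close>.\<close>

lemma koszul_exact_imp_nonzerodivisor:
  assumes J: "is_ideal J" and ex: "koszul_exact 0 (l # ls) J"
    and g: "l * g \<in> ideal_span (J \<union> set ls)"
  shows "g \<in> ideal_span (J \<union> set ls)"
proof -
  obtain c where c: "\<forall>bs\<in>cells (length ls) 0. l * g - koszul_d ls c bs \<in> J"
    using ideal_span_koszul_d[OF J g] .
  define c' where "c' = (\<lambda>t. if hd t then g else - c (tl t))"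
  have "\<forall>bs\<in>cells (length (l # ls)) 0. koszul_d (l # ls) c' bs \<in> J"
  proof
    fix bs assume "bs \<in> cells (length (l # ls)) 0"
    then obtain bs' where bs: "bs = False # bs'" "bs' \<in> cells (length ls) 0"
      by (cases bs) (auto simp: cells_def split: if_splits)
    then show "koszul_d (l # ls) c' bs \<in> J"
      using c by (simp add: c'_def koszul_d_uminus)
  qed
  with ex obtain e where e: "\<forall>bs\<in>cells (length (l # ls)) 1. c' bs - koszul_d (l # ls) e bs \<in> J"
    unfolding koszul_exact_def One_nat_def by blast
  \<comment> \<open>\<open>True # z\<close> is the basis vector of \<open>l\<close>, the one cell at
    which the cycle has the value \<open>g\<close>.\<close>
  define z where "z = replicate (length ls) False"
  have "count_list z True = 0" by (simp add: z_def count_list_0_iff)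
  then have "True # z \<in> cells (length (l # ls)) 1" by (simp add: cells_def z_def)
  with e have "g + koszul_d ls (\<lambda>t. e (True # t)) z \<in> J" by (force simp: c'_def)
  then have "g + koszul_d ls (\<lambda>t. e (True # t)) z \<in> ideal_span (J \<union> set ls)"
    by (auto intro: ideal_span_base)
  then show ?thesis
    using is_ideal_add_cancel[OF is_ideal_span koszul_d_in_ideal_span] by (metis add.commute)
qed

section \<open>Restricting a polynomial to some of its terms\<close>

text \<open>The one operation behind truncation by degree, substitution of zero for variables and
  initial forms, which differ only in the choice of \<open>P\<close>.\<close>

lift_definition restrict_terms :: "('a \<Rightarrow> bool) \<Rightarrow> ('a \<Rightarrow>\<^sub>0 'b::zero) \<Rightarrow> ('a \<Rightarrow>\<^sub>0 'b)"
  is "\<lambda>P f u. if P u then f u else 0"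
  by (rule finite_subset[rotated]) auto

lemma lookup_restrict_terms:
  "Poly_Mapping.lookup (restrict_terms P p) u = (if P u then Poly_Mapping.lookup p u else 0)"
  by transfer simp

lemma keys_restrict_terms: "Poly_Mapping.keys (restrict_terms P p) = {u \<in> Poly_Mapping.keys p. P u}"
  by (auto simp: in_keys_iff lookup_restrict_terms split: if_splits)

lemma restrict_terms_zero: "restrict_terms P 0 = 0"
  by (rule poly_mapping_eqI) (simp add: lookup_restrict_terms)

lemma restrict_terms_add: "restrict_terms P (p + q) = restrict_terms P p + restrict_terms P q"
  for p :: "'a \<Rightarrow>\<^sub>0 'b::monoid_add"
  by (rule poly_mapping_eqI) (simp add: lookup_restrict_terms lookup_add)

lemma restrict_terms_diff: "restrict_terms P (p - q) = restrict_terms P p - restrict_terms P q"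
  for p :: "'a \<Rightarrow>\<^sub>0 'b::ab_group_add"
  by (rule poly_mapping_eqI) (simp add: lookup_restrict_terms lookup_minus)

lemma restrict_terms_uminus: "restrict_terms P (- p) = - restrict_terms P p"
  for p :: "'a \<Rightarrow>\<^sub>0 'b::ab_group_add"
  by (rule poly_mapping_eqI) (simp add: lookup_restrict_terms)

lemma restrict_terms_single:
  "restrict_terms P (Poly_Mapping.single u c) = (if P u then Poly_Mapping.single u c else 0)"
  by (rule poly_mapping_eqI) (auto simp: lookup_restrict_terms lookup_single when_def)

lemma restrict_terms_ident:
  "(\<And>u. u \<in> Poly_Mapping.keys p \<Longrightarrow> P u) \<Longrightarrow> restrict_terms P p = p"
  by (rule poly_mapping_eqI) (auto simp: lookup_restrict_terms in_keys_iff)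

lemma poly_mapping_sum_single:
  fixes p :: "'a \<Rightarrow>\<^sub>0 'b::comm_monoid_add"
  shows "(\<Sum>u\<in>Poly_Mapping.keys p. Poly_Mapping.single u (Poly_Mapping.lookup p u)) = p"
  by (rule poly_mapping_eqI) (simp add: lookup_sum lookup_single when_def in_keys_iff)

lemma poly_mapping_single_induct [case_names single zero add]:
  fixes p :: "'a \<Rightarrow>\<^sub>0 'b::comm_monoid_add"
  assumes single: "\<And>u c. u \<in> Poly_Mapping.keys p \<Longrightarrow> Q (Poly_Mapping.single u c)"
    and zero: "Q 0" and add: "\<And>q r. Q q \<Longrightarrow> Q r \<Longrightarrow> Q (q + r)"
  shows "Q p"
proof -
  have "Q (\<Sum>u\<in>U. Poly_Mapping.single u (Poly_Mapping.lookup p u))"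
    if "U \<subseteq> Poly_Mapping.keys p" for U
    using finite_subset[OF that finite_keys] that
    by (induction U rule: finite_induct) (auto intro: single zero add)
  from this[of "Poly_Mapping.keys p"] show ?thesis by (simp add: poly_mapping_sum_single)
qed

text \<open>Asking for the splitting only at exponents that occur in \<open>p\<close> covers
  multiplication by a linear form, which shifts degrees by exactly one, as well as the substitution
  of zero for variables.\<close>

lemma restrict_terms_mult:
  fixes p q :: "'a::comm_monoid_add \<Rightarrow>\<^sub>0 'b::comm_semiring_0"
  assumes "\<And>u v. u \<in> Poly_Mapping.keys p \<Longrightarrow> P (u + v) \<longleftrightarrow> Q u \<and> R v"
  shows "restrict_terms P (p * q) = restrict_terms Q p * restrict_terms R q"
proof (induction p rule: poly_mapping_single_induct)
  case (single u c)
  then have P: "P (u + v) \<longleftrightarrow> Q u \<and> R v" for v using assms by blast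
  show ?case
  proof (induction q rule: poly_mapping_single_induct)
    case (single v d)
    show ?case by (auto simp: mult_single restrict_terms_single P)
  qed (simp_all add: restrict_terms_add restrict_terms_zero distrib_left)
qed (simp_all add: restrict_terms_add restrict_terms_zero distrib_right)

section \<open>Truncation by degree\<close>

definition expo_degree :: "('n::finite) expo \<Rightarrow> nat" where
  "expo_degree u = (\<Sum>j\<in>UNIV. Poly_Mapping.lookup u j)"

lemma expo_degree_add: "expo_degree (u + v) = expo_degree u + expo_degree v"
  by (simp add: expo_degree_def lookup_add sum.distrib)

lemma expo_degree_single: "expo_degree (Poly_Mapping.single j k) = k"
  by (simp add: expo_degree_def lookup_single when_def)

abbreviation trunc :: "nat \<Rightarrow> ('n::finite) mpol \<Rightarrow> 'n mpol" where
  "trunc N \<equiv> restrict_terms (\<lambda>u. expo_degree u < N)"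

definition linear_homogeneous :: "('n::finite) mpol \<Rightarrow> bool" where
  "linear_homogeneous p \<longleftrightarrow> (\<forall>u\<in>Poly_Mapping.keys p. expo_degree u = 1)"

lemma trunc_linear_mult:
  assumes "linear_homogeneous l"
  shows "trunc (Suc N) (l * p) = l * trunc N p"
proof -
  have "trunc (Suc N) (l * p) = restrict_terms (\<lambda>_. True) l * trunc N p"
    using assms by (intro restrict_terms_mult) (auto simp: linear_homogeneous_def expo_degree_add)
  then show ?thesis by (simp add: restrict_terms_ident)
qed

lemma trunc_0: "trunc 0 p = 0"
  by (rule poly_mapping_eqI) (simp add: lookup_restrict_terms)

lemma trunc_large: "\<exists>N. \<forall>M\<ge>N. trunc M p = p"
proof -
  obtain N where "expo_degree u < N" if "u \<in> Poly_Mapping.keys p" for u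
    using finite_nat_set_iff_bounded[of "expo_degree ` Poly_Mapping.keys p"] by auto
  then show ?thesis
    by (intro exI[of _ N] allI impI restrict_terms_ident) (meson less_le_trans)
qed

lemma koszul_d_trunc:
  assumes "\<forall>l\<in>set ls. linear_homogeneous l"
  shows "koszul_d ls (\<lambda>t. trunc N (c t)) bs = trunc (Suc N) (koszul_d ls c bs)"
  using assms
  by (induction ls c bs rule: koszul_d.induct)
     (simp_all add: trunc_linear_mult restrict_terms_add restrict_terms_uminus restrict_terms_zero)

text \<open>Graded Nakayama: multiplication by \<open>l\<close> is surjective on the first homology of \<open>ls\<close>, whose
  degrees are bounded below.\<close>

lemma koszul_exact_tail:
  fixes l :: "('n::finite) mpol"
  assumes J: "is_ideal J" and graded: "\<And>N p. p \<in> J \<Longrightarrow> trunc N p \<in> J"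
    and lin: "linear_homogeneous l" "\<forall>l\<in>set ls. linear_homogeneous l"
    and ex: "koszul_exact 0 (l # ls) J"
  shows "koszul_exact 0 ls J"
proof -
  let ?B = "cells (length ls)"
  \<comment> \<open>\<open>N\<close> bounds the degrees occurring in \<open>c\<close>; truncation
    below degree 0 leaves nothing, so the induction starts with \<open>c\<close> zero on the
    relevant cells.\<close>
  have *: "\<exists>e. \<forall>bs\<in>?B 1. c bs - koszul_d ls e bs \<in> J"
    if "\<forall>bs\<in>?B 0. koszul_d ls c bs \<in> J" "\<forall>bs\<in>?B 1. trunc N (c bs) = c bs" for c N
    using that
  proof (induction N arbitrary: c)
    case 0
    then have "\<forall>bs\<in>?B 1. c bs - koszul_d ls (\<lambda>_. 0) bs \<in> J"
      by (metis diff_zero is_ideal_0[OF J] koszul_d_zero trunc_0)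
    then show ?case by blast
  next
    case (Suc N)
    \<comment> \<open>Extended by zero on the cells containing \<open>l\<close>, the cycle
      \<open>c\<close> remains a cycle. As a boundary it has the form
      \<open>c = d e0 + l * e1\<close> modulo \<open>J\<close>, where \<open>e1\<close> is again a
      cycle.\<close>
    define c' where "c' = (\<lambda>t. if hd t then 0 else c (tl t))"
    have "\<forall>bs\<in>cells (length (l # ls)) 0. koszul_d (l # ls) c' bs \<in> J"
    proof
      fix bs assume "bs \<in> cells (length (l # ls)) 0"
      then obtain bs' where bs: "bs = False # bs'" "bs' \<in> ?B 0"
        by (cases bs) (auto simp: cells_def split: if_splits)
      then show "koszul_d (l # ls) c' bs \<in> J"
        using Suc.prems(1) by (simp add: c'_def)
    qed
    with ex obtain e where
      e: "\<forall>bs\<in>cells (length (l # ls)) 1. c' bs - koszul_d (l # ls) e bs \<in> J"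
      unfolding koszul_exact_def One_nat_def by blast
    define e0 e1 where "e0 = (\<lambda>t. e (False # t))" and "e1 = (\<lambda>t. e (True # t))"
    have e1: "koszul_d ls e1 bs \<in> J" if "bs \<in> ?B 0" for bs
    proof -
      have "True # bs \<in> cells (length (l # ls)) 1" using that by (simp add: Cons_cells)
      from e[rule_format, OF this] show ?thesis by (simp add: c'_def e1_def)
    qed
    \<comment> \<open>Truncating this equation at \<open>Suc N\<close> fixes \<open>c\<close> and,
      as \<open>l\<close> has degree 1, cuts \<open>e1\<close> below \<open>N\<close>; this is what
      makes the induction descend.\<close>
    have e0: "c bs - koszul_d ls (\<lambda>t. trunc N (e0 t)) bs - l * trunc N (e1 bs) \<in> J"
      if "bs \<in> ?B 1" for bs
    proof -
      have "False # bs \<in> cells (length (l # ls)) 1" using that by (simp add: Cons_cells)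
      from e[rule_format, OF this] have "c bs - koszul_d ls e0 bs - l * e1 bs \<in> J"
        by (simp add: c'_def e1_def e0_def algebra_simps)
      from graded[OF this, of "Suc N"] show ?thesis
        using Suc.prems(2) that
        by (simp add: restrict_terms_diff koszul_d_trunc[OF lin(2)] trunc_linear_mult[OF lin(1)])
    qed
    have "\<exists>e. \<forall>bs\<in>?B 1. trunc N (e1 bs) - koszul_d ls e bs \<in> J"
    proof (rule Suc.IH)
      show "\<forall>bs\<in>?B 0. koszul_d ls (\<lambda>t. trunc N (e1 t)) bs \<in> J"
        using e1 by (simp add: koszul_d_trunc[OF lin(2)] graded)
      show "\<forall>bs\<in>?B 1. trunc N (trunc N (e1 bs)) = trunc N (e1 bs)"
        by (auto intro!: restrict_terms_ident simp: keys_restrict_terms)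
    qed
    then obtain f where f: "\<forall>bs\<in>?B 1. trunc N (e1 bs) - koszul_d ls f bs \<in> J" by blast
    have "c bs - koszul_d ls (\<lambda>t. trunc N (e0 t) + l * f t) bs \<in> J" if bs: "bs \<in> ?B 1" for bs
      using is_ideal_add[OF J e0[OF bs] is_ideal_mult[OF J f[rule_format, OF bs], of l]]
      by (simp add: koszul_d_add koszul_d_mult algebra_simps)
    then show ?case by blast
  qed
  show ?thesis
    unfolding koszul_exact_def
  proof (intro allI impI)
    fix c assume c: "\<forall>bs\<in>?B 0. koszul_d ls c bs \<in> J"
    have "\<forall>bs. \<exists>N. \<forall>M\<ge>N. trunc M (c bs) = c bs" using trunc_large by blast
    then obtain n where n: "\<forall>bs. \<forall>M\<ge>n bs. trunc M (c bs) = c bs" by (rule choice[THEN exE])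
    have "\<forall>bs\<in>?B 1. trunc (Max (n ` ?B 1)) (c bs) = c bs"
      using n by (simp add: finite_cells)
    with * c show "\<exists>e. \<forall>bs\<in>?B (Suc 0). c bs - koszul_d ls e bs \<in> J"
      by (metis One_nat_def)
  qed
qed

lemma regular_mod_snoc:
  "regular_mod J (fs @ [f]) \<longleftrightarrow> regular_mod J fs \<and>
     (\<forall>g. f * g \<in> ideal_span (J \<union> set fs) \<longrightarrow> g \<in> ideal_span (J \<union> set fs))"
  by (auto simp: regular_mod_def nth_append less_Suc_eq)

text \<open>\<open>koszul_exact_tail\<close> drops the head of the list, whereas a regular sequence
  is shortened at its end; the reversal reconciles the two without reordering a Koszul
  complex.\<close>

lemma regular_mod_if_koszul_exact:
  fixes ls :: "('n::finite) mpol list"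
  assumes J: "is_ideal J" and graded: "\<And>N p. p \<in> J \<Longrightarrow> trunc N p \<in> J"
  shows "\<forall>l\<in>set ls. linear_homogeneous l \<Longrightarrow> koszul_exact 0 (rev ls) J \<Longrightarrow> regular_mod J ls"
proof (induction ls rule: rev_induct)
  case Nil
  then show ?case by (simp add: regular_mod_def)
next
  case (snoc l ls)
  have ex: "koszul_exact 0 (l # rev ls) J" using snoc.prems by simp
  have "koszul_exact 0 (rev ls) J"
    by (rule koszul_exact_tail[OF J graded _ _ ex]) (use snoc.prems in auto)
  then show ?case
    using snoc koszul_exact_imp_nonzerodivisor[OF J ex] by (auto simp: regular_mod_snoc)
qed

text \<open>Depth enters through \<open>fs\<close>, which may be inhomogeneous. Only
  \<open>J\<close> and \<open>ls\<close> have to be graded, because truncation by degree is applied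
  after \<open>fs\<close> has served to make the homology vanish.\<close>

theorem regular_mod_parameters:
  fixes ls :: "('n::finite) mpol list"
  assumes J: "is_ideal J" and graded: "\<And>N p. p \<in> J \<Longrightarrow> trunc N p \<in> J"
    and lin: "\<forall>l\<in>set ls. linear_homogeneous l"
    and fs: "regular_mod J fs" "length ls \<le> length fs"
    and pow: "\<And>f. f \<in> set fs \<Longrightarrow> \<exists>N. f ^ N \<in> ideal_span (J \<union> set ls)"
  shows "regular_mod J ls"
proof (rule regular_mod_if_koszul_exact[OF J graded lin])
  show "koszul_exact 0 (rev ls) J"
    using fs pow by (intro koszul_exact_if_regular[OF J fs(1)]) auto
qed

section \<open>Quotients of a commutative ring\<close>

text \<open>The definitions use rings with explicit carriers, the Koszul argument a ring type class.
  The surjection \<open>\<phi>\<close> transports ideals, primes and regular sequences between the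
  two, with its kernel in the role of \<open>J\<close>.\<close>

locale ring_presentation = cring R for R :: "('b, 'm) ring_scheme" (structure) +
  fixes \<phi> :: "'a::comm_ring_1 \<Rightarrow> 'b"
  assumes hom_add: "\<phi> (x + y) = \<phi> x \<oplus> \<phi> y"
    and hom_mult: "\<phi> (x * y) = \<phi> x \<otimes> \<phi> y"
    and hom_one: "\<phi> 1 = \<one>"
    and hom_range: "range \<phi> = carrier R"
begin

definition hom_kernel :: "'a set" where "hom_kernel = {x. \<phi> x = \<zero>}"

lemma hom_closed [simp]: "\<phi> x \<in> carrier R"
  using hom_range by blast

lemma hom_zero: "\<phi> 0 = \<zero>"
  using hom_add[of 0 0] by (metis add.r_cancel_one hom_closed add.left_neutral)

lemma hom_uminus: "\<phi> (- x) = \<ominus> \<phi> x"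
  using hom_add[of x "- x"] by (metis ab_left_minus add.commute hom_closed hom_zero minus_equality hom_add)

lemma hom_diff: "\<phi> (x - y) = \<phi> x \<ominus> \<phi> y"
  using hom_add[of x "- y"] by (simp add: hom_uminus a_minus_def)

lemma is_ideal_vimage:
  assumes "ideal I R"
  shows "is_ideal {x. \<phi> x \<in> I}"
proof -
  interpret I: ideal I R by fact
  show ?thesis
    by (rule is_idealI) (auto simp: hom_zero hom_add hom_mult I.I_l_closed)
qed

lemma hom_eq_iff: "\<phi> x = \<phi> y \<longleftrightarrow> x - y \<in> hom_kernel"
  by (simp add: hom_kernel_def hom_diff)

lemma mem_image_iff:
  assumes "is_ideal P" "hom_kernel \<subseteq> P"
  shows "\<phi> x \<in> \<phi> ` P \<longleftrightarrow> x \<in> P"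
proof
  assume "\<phi> x \<in> \<phi> ` P"
  then obtain y where "y \<in> P" "x - y \<in> hom_kernel" using hom_eq_iff by blast
  then show "x \<in> P" using assms is_ideal_diff_cong by blast
qed auto

lemma ideal_image:
  assumes P: "is_ideal P"
  shows "ideal (\<phi> ` P) R"
proof (rule idealI)
  show "ring R" by (rule ring_axioms)
  show "subgroup (\<phi> ` P) (add_monoid R)"
  proof (rule group.subgroupI)
    show "group (add_monoid R)" by (rule a_group)
    show "\<phi> ` P \<subseteq> carrier (add_monoid R)" by auto
    show "\<phi> ` P \<noteq> {}" using is_ideal_0[OF P] by blast
    show "inv\<^bsub>add_monoid R\<^esub> a \<in> \<phi> ` P" if "a \<in> \<phi> ` P" for a
    proof -
      from that obtain x where "x \<in> P" "a = \<phi> x" by blast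
      then have "\<ominus> a = \<phi> (- x)" "- x \<in> P" by (simp_all add: hom_uminus is_ideal_uminus[OF P])
      then show ?thesis by (simp add: a_inv_def)
    qed
    show "a \<otimes>\<^bsub>add_monoid R\<^esub> b \<in> \<phi> ` P" if "a \<in> \<phi> ` P" "b \<in> \<phi> ` P" for a b
      using that is_ideal_add[OF P] by (auto simp flip: hom_add)
  qed
  fix a x assume "a \<in> \<phi> ` P" "x \<in> carrier R"
  then obtain p q where "p \<in> P" "a = \<phi> p" "x = \<phi> q" using hom_range by blast
  then show "x \<otimes> a \<in> \<phi> ` P" "a \<otimes> x \<in> \<phi> ` P"
    using is_ideal_mult[OF P] is_ideal_mult'[OF P] by (auto simp flip: hom_mult)
qed

lemma primeideal_image:
  assumes P: "is_ideal P" and ker: "hom_kernel \<subseteq> P" and one: "1 \<notin> P"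
    and prime: "\<And>x y. x * y \<in> P \<Longrightarrow> x \<in> P \<or> y \<in> P"
  shows "primeideal (\<phi> ` P) R"
proof (rule primeidealI)
  show "ideal (\<phi> ` P) R" by (rule ideal_image[OF P])
  show "cring R" by (rule is_cring)
  show "carrier R \<noteq> \<phi> ` P" using mem_image_iff[OF P ker] one hom_closed by metis
  fix a b assume "a \<in> carrier R" "b \<in> carrier R" and ab: "a \<otimes> b \<in> \<phi> ` P"
  then obtain x y where "a = \<phi> x" "b = \<phi> y" using hom_range by blast
  with ab show "a \<in> \<phi> ` P \<or> b \<in> \<phi> ` P"
    using mem_image_iff[OF P ker] prime by (simp flip: hom_mult)
qed

lemma maximalideal_image:
  assumes P: "is_ideal P" and ker: "hom_kernel \<subseteq> P" and one: "1 \<notin> P"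
    and unit: "\<And>x. x \<notin> P \<Longrightarrow> \<exists>y. x * y - 1 \<in> P"
  shows "maximalideal (\<phi> ` P) R"
proof (rule maximalidealI)
  show "ideal (\<phi> ` P) R" by (rule ideal_image[OF P])
  show "carrier R \<noteq> \<phi> ` P" using mem_image_iff[OF P ker] one hom_closed by metis
  fix I assume I: "ideal I R" "\<phi> ` P \<subseteq> I" "I \<subseteq> carrier R"
  interpret I: ideal I R by fact
  let ?I = "{x. \<phi> x \<in> I}"
  have I': "is_ideal ?I" by (rule is_ideal_vimage[OF I(1)])
  show "I = \<phi> ` P \<or> I = carrier R"
  proof (rule disjCI)
    assume "I \<noteq> carrier R"
    then have "\<one> \<notin> I" using I.one_imp_carrier by blast
    then have 1: "1 \<notin> ?I" by (simp add: hom_one)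
    show "I = \<phi> ` P"
    proof
      show "I \<subseteq> \<phi> ` P"
      proof
        fix a assume a: "a \<in> I"
        then have "a \<in> range \<phi>" using I(3) hom_range by auto
        then obtain x where "a = \<phi> x" by (rule rangeE)
        then have x: "a = \<phi> x" "x \<in> ?I" using a by simp_all
        have "x \<in> P"
        proof (rule ccontr)
          assume "x \<notin> P"
          then obtain y where "x * y - 1 \<in> P" using unit by blast
          then have "x * y - 1 \<in> ?I" using I(2) by auto
          moreover have "x * y \<in> ?I" by (rule is_ideal_mult'[OF I' x(2)])
          ultimately show False using is_ideal_diff_cong[OF I'] 1 by blast
        qed
        then show "a \<in> \<phi> ` P" using x by blast
      qed
    qed (rule I(2))
  qed
qed

lemma hom_mem_genideal_iff: "\<phi> x \<in> Idl (\<phi> ` F) \<longleftrightarrow> x \<in> ideal_span (hom_kernel \<union> F)"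
proof
  have "Idl (\<phi> ` F) \<subseteq> \<phi> ` ideal_span (hom_kernel \<union> F)"
    by (intro genideal_minimal ideal_image is_ideal_span image_mono) (auto intro: ideal_span_base)
  moreover have "hom_kernel \<subseteq> ideal_span (hom_kernel \<union> F)" by (auto intro: ideal_span_base)
  ultimately show "\<phi> x \<in> Idl (\<phi> ` F) \<Longrightarrow> x \<in> ideal_span (hom_kernel \<union> F)"
    using mem_image_iff[OF is_ideal_span] by blast
next
  have F: "\<phi> ` F \<subseteq> carrier R" by auto
  have I: "ideal (Idl (\<phi> ` F)) R" by (rule genideal_ideal[OF F])
  have "ideal_span (hom_kernel \<union> F) \<subseteq> {x. \<phi> x \<in> Idl (\<phi> ` F)}"
    using genideal_self[OF F] is_ideal_vimage[OF I] is_ideal_0[OF is_ideal_vimage[OF I]]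
    by (intro ideal_span_minimal) (auto simp: hom_kernel_def hom_zero)
  then show "x \<in> ideal_span (hom_kernel \<union> F) \<Longrightarrow> \<phi> x \<in> Idl (\<phi> ` F)" by blast
qed

lemma regular_sequence_map_iff:
  "regular_sequence R (map \<phi> fs) \<longleftrightarrow>
     regular_mod hom_kernel fs \<and> 1 \<notin> ideal_span (hom_kernel \<union> set fs)"
proof -
  have "Idl (\<phi> ` set fs) = carrier R \<longleftrightarrow> \<phi> 1 \<in> Idl (\<phi> ` set fs)"
  proof
    assume "\<phi> 1 \<in> Idl (\<phi> ` set fs)"
    then show "Idl (\<phi> ` set fs) = carrier R"
      by (intro ideal.one_imp_carrier genideal_ideal) (auto simp: hom_one)
  qed simp
  moreover have "(\<forall>i<length (map \<phi> fs). \<forall>g\<in>carrier R.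
        map \<phi> fs ! i \<otimes> g \<in> Idl (set (take i (map \<phi> fs))) \<longrightarrow> g \<in> Idl (set (take i (map \<phi> fs))))
      \<longleftrightarrow> regular_mod hom_kernel fs"
    by (simp add: regular_mod_def take_map flip: hom_range hom_mult hom_mem_genideal_iff)
  ultimately show ?thesis
    by (auto simp: regular_sequence_def hom_mem_genideal_iff)
qed

end

section \<open>Polynomial rings\<close>

abbreviation poly_proj :: "'n set \<Rightarrow> 'n mpol \<Rightarrow> 'n mpol" where
  "poly_proj V \<equiv> restrict_terms (\<lambda>u. Poly_Mapping.keys u \<subseteq> V)"

lemma keys_add_expo: "Poly_Mapping.keys (u + v) = Poly_Mapping.keys u \<union> Poly_Mapping.keys v"
  for u v :: "'n expo"
  by (auto simp: in_keys_iff lookup_add)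

lemma poly_proj_mult: "poly_proj V (p * q) = poly_proj V p * poly_proj V q"
  by (rule restrict_terms_mult) (auto simp: keys_add_expo)

lemma poly_proj_one: "poly_proj V 1 = 1"
  by (rule restrict_terms_ident) simp

lemma carrier_mpol_ring: "p \<in> carrier (mpol_ring V) \<longleftrightarrow> poly_proj V p = p"
proof
  assume "poly_proj V p = p"
  then have "Poly_Mapping.keys p = {u \<in> Poly_Mapping.keys p. Poly_Mapping.keys u \<subseteq> V}"
    using keys_restrict_terms by metis
  then show "p \<in> carrier (mpol_ring V)" by (auto simp: mpol_ring_def)
qed (auto simp: mpol_ring_def intro: restrict_terms_ident)

lemma poly_proj_carrier: "poly_proj V p \<in> carrier (mpol_ring V)"
  by (simp add: mpol_ring_def keys_restrict_terms)

lemma mpol_ring_sel [simp]: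
  "mult (mpol_ring V) = (*)" "one (mpol_ring V) = 1" "zero (mpol_ring V) = 0"
  "add (mpol_ring V) = (+)"
  by (simp_all add: mpol_ring_def)

lemma cring_mpol_ring: "cring (mpol_ring V)"
proof (rule cringI)
  show "abelian_group (mpol_ring V)"
  proof (rule abelian_groupI, goal_cases)
    case (6 x)
    then show ?case
      by (intro bexI[of _ "- x"]) (simp_all add: carrier_mpol_ring restrict_terms_uminus)
  qed (simp_all add: carrier_mpol_ring restrict_terms_add restrict_terms_zero algebra_simps)
  show "comm_monoid (mpol_ring V)"
    by (rule comm_monoidI)
       (simp_all add: carrier_mpol_ring poly_proj_mult poly_proj_one algebra_simps)
qed (simp add: algebra_simps)

lemma ideal_mpol_ring_UNIV: "ideal I (mpol_ring UNIV) \<longleftrightarrow> is_ideal I"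
proof -
  interpret S: ring_presentation "mpol_ring UNIV" "\<lambda>x. x"
    by (intro ring_presentation.intro cring_mpol_ring ring_presentation_axioms.intro)
       (auto simp: mpol_ring_def)
  show ?thesis using S.is_ideal_vimage[of I] S.ideal_image[of I] by auto
qed

lemma genideal_mpol_ring_UNIV: "Idl\<^bsub>mpol_ring UNIV\<^esub> F = ideal_span F"
  unfolding genideal_def ideal_mpol_ring_UNIV
  by (auto intro: ideal_span_base is_ideal_span dest: ideal_span_minimal)

text \<open>The product of the leading terms of \<open>p\<close> and \<open>q\<close> cannot cancel:
  no other pair of terms has the same exponent sum.\<close>

lemma mpol_mult_eq_0:
  fixes p q :: "('n::finite) mpol"
  assumes "p * q = 0"
  shows "p = 0 \<or> q = 0"
proof (rule ccontr)
  assume nz: "\<not> (p = 0 \<or> q = 0)"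
  obtain \<iota> :: "'n \<Rightarrow> nat" where \<iota>: "inj \<iota>"
    using finite_imp_inj_to_nat_seg[of "UNIV :: 'n set"] by auto
  \<comment> \<open>The index type \<open>'n\<close> carries no order. Exponents are therefore moved
    to the index type \<open>nat\<close>, where they are linearly ordered compatibly with
    addition.\<close>
  define \<rho> :: "'n expo \<Rightarrow> nat \<Rightarrow>\<^sub>0 nat"
    where "\<rho> u = (\<Sum>j\<in>UNIV. Poly_Mapping.single (\<iota> j) (Poly_Mapping.lookup u j))" for u
  have \<rho>_add: "\<rho> (u + v) = \<rho> u + \<rho> v" for u v
    by (simp add: \<rho>_def lookup_add single_add sum.distrib)
  have "Poly_Mapping.lookup (\<rho> u) (\<iota> j) = Poly_Mapping.lookup u j" for u j
    using \<iota> by (simp add: \<rho>_def lookup_sum lookup_single inj_eq when_def)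
  then have \<rho>_inj: "u = v" if "\<rho> u = \<rho> v" for u v
    using that by (metis poly_mapping_eqI)
  have max: "\<exists>u\<in>Poly_Mapping.keys r. \<forall>u'\<in>Poly_Mapping.keys r. \<rho> u' \<le> \<rho> u" if "r \<noteq> 0" for r :: "'n mpol"
  proof -
    have "finite (\<rho> ` Poly_Mapping.keys r)" "\<rho> ` Poly_Mapping.keys r \<noteq> {}" using that by auto
    from Max_in[OF this] obtain u
      where u: "Max (\<rho> ` Poly_Mapping.keys r) = \<rho> u" "u \<in> Poly_Mapping.keys r" by (rule imageE)
    then have "\<forall>u'\<in>Poly_Mapping.keys r. \<rho> u' \<le> \<rho> u" by (simp flip: u(1))
    with u(2) show ?thesis by blast
  qed
  from max nz obtain u where u: "u \<in> Poly_Mapping.keys p" "\<forall>u'\<in>Poly_Mapping.keys p. \<rho> u' \<le> \<rho> u"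
    by blast
  from max nz obtain v where v: "v \<in> Poly_Mapping.keys q" "\<forall>v'\<in>Poly_Mapping.keys q. \<rho> v' \<le> \<rho> v"
    by blast
  have eq: "a + b = u + v \<longleftrightarrow> a = u \<and> b = v"
    if "a \<in> Poly_Mapping.keys p" "b \<in> Poly_Mapping.keys q" for a b
  proof
    assume "a + b = u + v"
    then have "\<rho> a + \<rho> b = \<rho> u + \<rho> v" by (metis \<rho>_add)
    moreover have "\<rho> a \<le> \<rho> u" "\<rho> b \<le> \<rho> v" using u v that by auto
    ultimately have "\<rho> a = \<rho> u" "\<rho> b = \<rho> v"
      by (metis add_le_less_mono add_less_le_mono less_irrefl order_le_less)+
    then show "a = u \<and> b = v" using \<rho>_inj by blast
  qed simp
  have "p * q = (\<Sum>a\<in>Poly_Mapping.keys p. \<Sum>b\<in>Poly_Mapping.keys q.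
      Poly_Mapping.single (a + b) (Poly_Mapping.lookup p a * Poly_Mapping.lookup q b))"
    by (subst (1 2) poly_mapping_sum_single[symmetric])
       (simp add: sum_product mult_single)
  then have "Poly_Mapping.lookup (p * q) (u + v) =
    (\<Sum>a\<in>Poly_Mapping.keys p. \<Sum>b\<in>Poly_Mapping.keys q.
       if a + b = u + v then Poly_Mapping.lookup p a * Poly_Mapping.lookup q b else 0)"
    by (simp add: lookup_sum lookup_single when_def)
  also have "\<dots> = (\<Sum>a\<in>Poly_Mapping.keys p. \<Sum>b\<in>Poly_Mapping.keys q.
       if a = u then if b = v then Poly_Mapping.lookup p a * Poly_Mapping.lookup q b else 0 else 0)"
    by (intro sum.cong refl) (auto simp: eq)
  also have "\<dots> = (\<Sum>a\<in>Poly_Mapping.keys p. if a = u then Poly_Mapping.lookup p a * Poly_Mapping.lookup q v else 0)"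
    using v by (intro sum.cong refl) auto
  also have "\<dots> = Poly_Mapping.lookup p u * Poly_Mapping.lookup q v"
    using u by simp
  finally show False using assms u v by (simp add: in_keys_iff)
qed

section \<open>Stanley--Reisner rings\<close>

text \<open>The Stanley--Reisner ideal taken in all \<open>n\<close> variables, so that
  \<open>V\<close> disappears: a variable outside \<open>V\<close> is a nonface and is killed
  anyway. For \<open>Pow F\<close> it is the prime generated by the variables outside
  \<open>F\<close>, for \<open>Pow {}\<close> the irrelevant maximal ideal.\<close>

definition nonface_ideal :: "'n set set \<Rightarrow> 'n mpol set" where
  "nonface_ideal \<Delta> = {p. \<forall>u\<in>Poly_Mapping.keys p. Poly_Mapping.keys u \<notin> \<Delta>}"

lemma poly_proj_eq_0_iff: "poly_proj F p = 0 \<longleftrightarrow> p \<in> nonface_ideal (Pow F)"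
  by (auto simp: nonface_ideal_def keys_restrict_terms simp flip: keys_eq_empty)

lemma is_ideal_nonface_ideal:
  assumes down: "\<forall>\<sigma>\<in>\<Delta>. \<forall>\<tau>\<subseteq>\<sigma>. \<tau> \<in> \<Delta>"
  shows "is_ideal (nonface_ideal \<Delta>)"
proof (rule is_idealI)
  show "0 \<in> nonface_ideal \<Delta>" by (simp add: nonface_ideal_def)
  show "x + y \<in> nonface_ideal \<Delta>" if "x \<in> nonface_ideal \<Delta>" "y \<in> nonface_ideal \<Delta>" for x y
    using that keys_add[of x y] by (auto simp: nonface_ideal_def)
  show "c * x \<in> nonface_ideal \<Delta>" if "x \<in> nonface_ideal \<Delta>" for c x
  proof -
    have "Poly_Mapping.keys u \<notin> \<Delta>" if u: "u \<in> Poly_Mapping.keys (c * x)" for u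
    proof -
      obtain a b where "u = a + b" "b \<in> Poly_Mapping.keys x"
        using keys_mult[of c x] u by auto
      then show ?thesis
        using \<open>x \<in> nonface_ideal \<Delta>\<close> down by (auto simp: nonface_ideal_def keys_add_expo)
    qed
    then show ?thesis by (simp add: nonface_ideal_def)
  qed
qed

text \<open>The ideal is the kernel of the substitution of zero for the variables outside
  \<open>F\<close>, a homomorphism into a domain.\<close>

lemma primeideal_nonface_ideal:
  fixes x y :: "('n::finite) mpol"
  shows "x * y \<in> nonface_ideal (Pow F) \<Longrightarrow> x \<in> nonface_ideal (Pow F) \<or> y \<in> nonface_ideal (Pow F)"
  using mpol_mult_eq_0[of "poly_proj F x" "poly_proj F y"]
  by (simp add: poly_proj_mult flip: poly_proj_eq_0_iff)

lemma prod_Var: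
  fixes \<tau> :: "('n::finite) set"
  shows "(\<Prod>i\<in>\<tau>. Var i ^ b i) = monom (\<Sum>i\<in>\<tau>. Poly_Mapping.single i (b i))"
proof -
  have pow: "Var i ^ k = monom (Poly_Mapping.single i k)" for i :: 'n and k
    by (induction k) (simp_all add: Var_def monom_def mult_single flip: single_add)
  have "finite \<tau>" by simp
  then show ?thesis
    unfolding pow by (induction \<tau> rule: finite_induct) (simp_all add: monom_def mult_single)
qed

lemma keys_squarefree: "Poly_Mapping.keys (\<Sum>i\<in>\<tau>. Poly_Mapping.single i (1::nat)) = \<tau>"
  for \<tau> :: "('n::finite) set"
  by (auto simp: in_keys_iff lookup_sum lookup_single when_def split: if_splits)

text \<open>Every term is a multiple of the squarefree monomial of its support, which is a generator
  as soon as the support is a nonface inside \<open>V\<close>.\<close>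

lemma SR_ideal_eq:
  fixes \<Delta> :: "('n::finite) set set"
  assumes down: "\<forall>\<sigma>\<in>\<Delta>. \<forall>\<tau>\<subseteq>\<sigma>. \<tau> \<in> \<Delta>"
  shows "SR_ideal V \<Delta> = nonface_ideal \<Delta> \<inter> carrier (mpol_ring V)"
proof -
  interpret S: cring "mpol_ring V" by (rule cring_mpol_ring)
  let ?G = "{\<Prod>i\<in>\<tau>. Var i | \<tau>. \<tau> \<subseteq> V \<and> \<tau> \<notin> \<Delta>}"
  note J = is_ideal_nonface_ideal[OF down]
  have mon: "(\<Prod>i\<in>\<tau>. Var i) = monom (\<Sum>i\<in>\<tau>. Poly_Mapping.single i 1)" for \<tau> :: "'n set"
    using prod_Var[of "\<lambda>_. 1" \<tau>] by simp
  have G: "?G \<subseteq> nonface_ideal \<Delta> \<inter> carrier (mpol_ring V)"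
    unfolding mon by (auto simp: monom_def nonface_ideal_def keys_squarefree[simplified] mpol_ring_def)
  have "ideal (nonface_ideal \<Delta> \<inter> carrier (mpol_ring V)) (mpol_ring V)"
  proof (rule idealI)
    show "subgroup (nonface_ideal \<Delta> \<inter> carrier (mpol_ring V)) (add_monoid (mpol_ring V))"
    proof (rule group.subgroupI)
      show "group (add_monoid (mpol_ring V))" by (rule S.a_group)
      show "nonface_ideal \<Delta> \<inter> carrier (mpol_ring V) \<noteq> {}"
        using is_ideal_0[OF J] S.zero_closed by auto
      fix a assume a: "a \<in> nonface_ideal \<Delta> \<inter> carrier (mpol_ring V)"
      then have "\<ominus>\<^bsub>mpol_ring V\<^esub> a = - a"
        by (intro S.minus_equality) (auto simp: carrier_mpol_ring restrict_terms_uminus)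
      then show "inv\<^bsub>add_monoid (mpol_ring V)\<^esub> a \<in> nonface_ideal \<Delta> \<inter> carrier (mpol_ring V)"
        using a is_ideal_uminus[OF J]
        by (auto simp: a_inv_def carrier_mpol_ring restrict_terms_uminus)
    qed (auto simp: carrier_mpol_ring restrict_terms_add is_ideal_add[OF J])
  qed (auto simp: S.ring_axioms is_ideal_mult[OF J] is_ideal_mult'[OF J] carrier_mpol_ring poly_proj_mult)
  with G have "SR_ideal V \<Delta> \<subseteq> nonface_ideal \<Delta> \<inter> carrier (mpol_ring V)"
    unfolding SR_ideal_def by (intro S.genideal_minimal)
  moreover have "p \<in> SR_ideal V \<Delta>" if p: "p \<in> nonface_ideal \<Delta>" "p \<in> carrier (mpol_ring V)" for p
    using p
  proof -
    have GC: "?G \<subseteq> carrier (mpol_ring V)" using G by blast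
    interpret I: ideal "SR_ideal V \<Delta>" "mpol_ring V"
      unfolding SR_ideal_def by (rule S.genideal_ideal[OF GC])
    show ?thesis
    proof (induction p rule: poly_mapping_single_induct)
      case (single u c)
      let ?\<tau> = "Poly_Mapping.keys u"
      have \<tau>: "?\<tau> \<notin> \<Delta>" "?\<tau> \<subseteq> V" using p single by (auto simp: nonface_ideal_def mpol_ring_def)
      define s where "s = (\<Sum>i\<in>?\<tau>. Poly_Mapping.single i (1::nat))"
      have "(\<Prod>i\<in>?\<tau>. Var i) \<in> SR_ideal V \<Delta>"
        unfolding SR_ideal_def using \<tau> by (intro subsetD[OF S.genideal_self[OF GC]]) blast
      moreover have "Poly_Mapping.single (u - s) c \<in> carrier (mpol_ring V)"
        using \<tau> by (auto simp: mpol_ring_def in_keys_iff lookup_minus)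
      ultimately have "Poly_Mapping.single (u - s) c * (\<Prod>i\<in>?\<tau>. Var i) \<in> SR_ideal V \<Delta>"
        using I.I_l_closed by simp
      moreover have "u - s + s = u"
        by (rule poly_mapping_eqI)
           (auto simp: s_def lookup_add lookup_minus lookup_sum lookup_single when_def in_keys_iff)
      ultimately show ?case unfolding mon by (simp add: monom_def mult_single s_def)
    next
      case zero
      then show ?case using I.zero_closed by simp
    next
      case (add q r)
      then show ?case using I.a_closed by simp
    qed
  qed
  ultimately show ?thesis by blast
qed

lemma SR_ring_presentation:
  fixes \<Delta> :: "('n::finite) set set"
  assumes down: "\<forall>\<sigma>\<in>\<Delta>. \<forall>\<tau>\<subseteq>\<sigma>. \<tau> \<in> \<Delta>" and V: "\<forall>\<tau>\<in>\<Delta>. \<tau> \<subseteq> V"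
  shows "ring_presentation (SR_ring V \<Delta>) (\<lambda>p. SR_class V \<Delta> (poly_proj V p))"
    and "ring_presentation.hom_kernel (SR_ring V \<Delta>) (\<lambda>p. SR_class V \<Delta> (poly_proj V p)) = nonface_ideal \<Delta>"
proof -
  let ?\<phi> = "\<lambda>p. SR_class V \<Delta> (poly_proj V p)"
  interpret S: cring "mpol_ring V" by (rule cring_mpol_ring)
  have "{\<Prod>i\<in>\<tau>. Var i | \<tau>. \<tau> \<subseteq> V \<and> \<tau> \<notin> \<Delta>} \<subseteq> carrier (mpol_ring V)"
  proof -
    have "(\<Prod>i\<in>\<tau>. Var i) = monom (\<Sum>i\<in>\<tau>. Poly_Mapping.single i 1)" for \<tau> :: "'n set"
      using prod_Var[of "\<lambda>_. 1" \<tau>] by simp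
    then show ?thesis by (auto simp: monom_def keys_squarefree[simplified] mpol_ring_def)
  qed
  then interpret I: ideal "SR_ideal V \<Delta>" "mpol_ring V"
    unfolding SR_ideal_def by (rule S.genideal_ideal)
  have hom: "(+>\<^bsub>mpol_ring V\<^esub>) (SR_ideal V \<Delta>) \<in> ring_hom (mpol_ring V) (SR_ring V \<Delta>)"
    unfolding SR_ring_def by (rule I.rcos_ring_hom)
  show pres: "ring_presentation (SR_ring V \<Delta>) ?\<phi>"
  proof (intro ring_presentation.intro ring_presentation_axioms.intro)
    show "cring (SR_ring V \<Delta>)"
      unfolding SR_ring_def by (rule I.quotient_is_cring[OF cring_mpol_ring])
    show "?\<phi> (x + y) = ?\<phi> x \<oplus>\<^bsub>SR_ring V \<Delta>\<^esub> ?\<phi> y" for x y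
      using ring_hom_add[OF hom poly_proj_carrier poly_proj_carrier, of x y]
      by (simp add: SR_class_def restrict_terms_add)
    show "?\<phi> (x * y) = ?\<phi> x \<otimes>\<^bsub>SR_ring V \<Delta>\<^esub> ?\<phi> y" for x y
      using ring_hom_mult[OF hom poly_proj_carrier poly_proj_carrier, of x y]
      by (simp add: SR_class_def poly_proj_mult)
    show "?\<phi> 1 = \<one>\<^bsub>SR_ring V \<Delta>\<^esub>"
      using ring_hom_one[OF hom] by (simp add: SR_class_def poly_proj_one)
    show "range ?\<phi> = carrier (SR_ring V \<Delta>)"
    proof
      show "range ?\<phi> \<subseteq> carrier (SR_ring V \<Delta>)"
        using ring_hom_closed[OF hom poly_proj_carrier] by (auto simp: SR_class_def)
      have "carrier (SR_ring V \<Delta>) = SR_class V \<Delta> ` carrier (mpol_ring V)"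
        unfolding SR_ring_def FactRing_simps SR_class_def by auto
      then show "carrier (SR_ring V \<Delta>) \<subseteq> range ?\<phi>"
        by (auto simp: carrier_mpol_ring) (metis rangeI)
    qed
  qed
  interpret ring_presentation "SR_ring V \<Delta>" ?\<phi> by (rule pres)
  have "?\<phi> p = \<zero>\<^bsub>SR_ring V \<Delta>\<^esub> \<longleftrightarrow> poly_proj V p \<in> SR_ideal V \<Delta>" for p
    using S.a_coset_join1[OF _ poly_proj_carrier I.a_subgroup]
      S.a_coset_join2[OF poly_proj_carrier I.a_subgroup]
    by (auto simp: SR_ring_def FactRing_def SR_class_def)
  \<comment> \<open>The terms dropped by the projection involve a variable outside \<open>V\<close>,
    so their supports are nonfaces.\<close>
  moreover have "poly_proj V p \<in> SR_ideal V \<Delta> \<longleftrightarrow> p \<in> nonface_ideal \<Delta>" for p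
    using V by (auto simp: SR_ideal_eq[OF down] poly_proj_carrier nonface_ideal_def keys_restrict_terms)
  ultimately show "hom_kernel = nonface_ideal \<Delta>" by (simp add: hom_kernel_def)
qed

section \<open>Linear forms on a Stanley--Reisner ring\<close>

lemma Const_mult: "Const (a * b) = Const a * Const b"
  by (simp add: Const_def mult_single)

lemma Const_sum: "Const (sum f S) = (\<Sum>x\<in>S. Const (f x))"
  by (induction S rule: infinite_finite_induct) (simp_all add: Const_def single_add)

lemma Const_0 [simp]: "Const 0 = 0" and Const_1 [simp]: "Const 1 = 1"
  by (simp_all add: Const_def)

lemma lookup_Const_mult: "Poly_Mapping.lookup (Const c * p) u = c * Poly_Mapping.lookup p u"
  unfolding Const_def mult_map_scale_conv_mult[symmetric] by (simp add: map.rep_eq when_def)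

lemma lookup_Var: "Poly_Mapping.lookup (Var j) u = (if u = Poly_Mapping.single j 1 then 1 else 0)"
  by (auto simp: Var_def monom_def lookup_single when_def)

lemma linear_form_keys:
  assumes "linear_form V p" "u \<in> Poly_Mapping.keys p"
  obtains j where "j \<in> V" "u = Poly_Mapping.single j 1"
proof -
  obtain c where "p = (\<Sum>j\<in>V. Const (c j) * Var j)" using assms(1) by (auto simp: linear_form_def)
  then have "(\<Sum>j\<in>V. c j * (if u = Poly_Mapping.single j 1 then 1 else 0)) \<noteq> 0"
    using assms(2) by (simp add: in_keys_iff lookup_sum lookup_Const_mult lookup_Var)
  then obtain j where "j \<in> V" "u = Poly_Mapping.single j 1"
    by (rule sum.not_neutral_contains_not_neutral) (auto split: if_splits)
  then show ?thesis by (rule that)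
qed

lemma linear_form_linear_homogeneous: "linear_form V p \<Longrightarrow> linear_homogeneous p"
  by (auto simp: linear_homogeneous_def expo_degree_single elim!: linear_form_keys)

lemma linear_form_carrier: "linear_form V p \<Longrightarrow> p \<in> carrier (mpol_ring V)"
  by (auto simp: mpol_ring_def elim!: linear_form_keys)

lemma nonface_ideal_empty: "p \<in> nonface_ideal {{}} \<longleftrightarrow> Poly_Mapping.lookup p 0 = 0"
  by (auto simp: nonface_ideal_def in_keys_iff)

text \<open>In the quotient by the linear forms, a face monomial \<open>x\<^sub>\<tau>\<close> times one of its variables is a
  combination of such monomials for larger \<open>\<tau>\<close>; so all of them are nilpotent.\<close>

lemma variables_nilpotent:
  fixes \<Delta> :: "('n::finite) set set"
  assumes I: "is_ideal I" and J: "nonface_ideal \<Delta> \<subseteq> I"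
    and param: "\<And>\<tau> j. \<tau> \<in> \<Delta> \<Longrightarrow> j \<in> \<tau> \<Longrightarrow>
      \<exists>f. f j = 1 \<and> (\<forall>t\<in>\<tau> - {j}. f t = 0) \<and> (\<Sum>t\<in>UNIV. Const (f t) * Var t) \<in> I"
    and p: "Poly_Mapping.lookup p 0 = 0"
  shows "\<exists>N. p ^ N \<in> I"
proof -
  let ?N = "{p. \<exists>N. p ^ N \<in> I}"
  have N: "is_ideal ?N" by (rule is_ideal_radical[OF I])
  have IN: "I \<subseteq> ?N"
  proof
    fix p assume "p \<in> I"
    then have "p ^ 1 \<in> I" by simp
    then show "p \<in> ?N" by blast
  qed
  have mon: "(\<Prod>i\<in>\<tau>. Var i) \<in> ?N" if "\<tau> \<noteq> {}" for \<tau> :: "'n set"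
    using that
  proof (induction "card (- \<tau>)" arbitrary: \<tau> rule: less_induct)
    case less
    show ?case
    proof (cases "\<tau> \<in> \<Delta>")
      case False
      then have "(\<Prod>i\<in>\<tau>. Var i) \<in> nonface_ideal \<Delta>"
        using prod_Var[of "\<lambda>_. 1" \<tau>] keys_squarefree[of \<tau>]
        by (simp add: nonface_ideal_def monom_def)
      then show ?thesis using J IN by blast
    next
      case True
      obtain j where j: "j \<in> \<tau>" using less.prems by blast
      obtain f where f: "f j = 1" "\<forall>t\<in>\<tau> - {j}. f t = 0" "(\<Sum>t\<in>UNIV. Const (f t) * Var t) \<in> I"
        using param[OF True j] by blast
      let ?x = "\<Prod>i\<in>\<tau>. Var i"
      have split: "(\<Sum>t\<in>UNIV. Const (f t) * Var t) = Var j + (\<Sum>t\<in>- \<tau>. Const (f t) * Var t)"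
      proof -
        have "(\<Sum>t\<in>UNIV. Const (f t) * Var t)
            = (\<Sum>t\<in>\<tau>. Const (f t) * Var t) + (\<Sum>t\<in>- \<tau>. Const (f t) * Var t)"
          using sum.union_disjoint[of \<tau> "- \<tau>"] by (simp add: Compl_partition)
        also have "(\<Sum>t\<in>\<tau>. Const (f t) * Var t) = Const (f j) * Var j + (\<Sum>t\<in>\<tau> - {j}. Const (f t) * Var t)"
          using j by (intro sum.remove) auto
        also have "\<dots> = Var j" using f by simp
        finally show ?thesis .
      qed
      have n1: "?x * (\<Sum>t\<in>UNIV. Const (f t) * Var t) \<in> ?N"
        using is_ideal_mult[OF N] f(3) IN by blast
      have n2: "?x * (\<Sum>t\<in>- \<tau>. Const (f t) * Var t) \<in> ?N"
        unfolding sum_distrib_left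
      proof (rule is_ideal_sum[OF N])
        fix t assume t: "t \<in> - \<tau>"
        then have "- insert t \<tau> \<subset> - \<tau>" by auto
        then have "card (- insert t \<tau>) < card (- \<tau>)" by (intro psubset_card_mono) auto
        then have "(\<Prod>i\<in>insert t \<tau>. Var i) \<in> ?N" by (intro less.hyps) auto
        then have "Const (f t) * (\<Prod>i\<in>insert t \<tau>. Var i) \<in> ?N" by (rule is_ideal_mult[OF N])
        then show "?x * (Const (f t) * Var t) \<in> ?N" using t by (simp add: ac_simps)
      qed
      have "?x * Var j \<in> ?N"
        using is_ideal_diff[OF N n1 n2] by (simp add: split distrib_left)
      \<comment> \<open>The remaining variables of \<open>\<tau>\<close> complete this to the square
        of the face monomial, and nilpotence of the square suffices.\<close>
      then have "?x * Var j * (\<Prod>i\<in>\<tau> - {j}. Var i) \<in> ?N" by (rule is_ideal_mult'[OF N])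
      moreover have "Var j * (\<Prod>i\<in>\<tau> - {j}. Var i) = ?x"
        using j by (intro prod.remove[symmetric]) auto
      ultimately have "?x * ?x \<in> ?N" by (simp add: mult.assoc)
      then obtain M where "(?x ^ 2) ^ M \<in> I" by (auto simp: power2_eq_square)
      then show ?thesis by (auto simp flip: power_mult)
    qed
  qed
  have "p \<in> ?N"
  proof (induction p rule: poly_mapping_single_induct)
    case (single u c)
    then have "u \<noteq> 0" using p by (auto simp: in_keys_iff)
    then obtain j where "j \<in> Poly_Mapping.keys u" using keys_eq_empty by fastforce
    then have "u = (u - Poly_Mapping.single j 1) + Poly_Mapping.single j 1"
      by (intro poly_mapping_eqI) (auto simp: lookup_add lookup_minus lookup_single when_def in_keys_iff)
    then have "Poly_Mapping.single u c = Poly_Mapping.single (u - Poly_Mapping.single j 1) c * Var j"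
      by (simp add: Var_def monom_def mult_single)
    moreover have "Var j \<in> ?N" using mon[of "{j}"] by simp
    ultimately show ?case using is_ideal_mult[OF N, of "Var j"] by (simp only:)
  next
    case zero
    then show ?case by (rule is_ideal_0[OF N])
  next
    case (add q r)
    then show ?case by (rule is_ideal_add[OF N])
  qed
  then show ?thesis by simp
qed

text \<open>The supremum may be infinite and unattained, but sequences of length at most
  \<open>r - 1\<close> alone cannot push it to \<open>r\<close>. For \<open>r = 0\<close> the
  argument breaks down, as an empty supremum is 0 as well.\<close>

lemma ideal_depth_ge:
  assumes "enat r \<le> ideal_depth R m" "r > 0"
  shows "\<exists>fs. regular_sequence R fs \<and> set fs \<subseteq> m \<and> r \<le> length fs"
proof (rule ccontr)
  assume "\<not> ?thesis"
  then have "length fs \<le> r - 1" if "regular_sequence R fs" "set fs \<subseteq> m" for fs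
    using that by fastforce
  then have "ideal_depth R m \<le> enat (r - 1)"
    unfolding ideal_depth_def by (auto intro!: Sup_least)
  with assms(1) have "enat r \<le> enat (r - 1)" by (rule order_trans)
  with assms(2) show False by simp
qed

text \<open>\<open>param\<close> is the face-by-face criterion for linear parameters and serves to
  make all variables nilpotent; the size of \<open>F\<close> bounds the height of the irrelevant
  ideal from below.\<close>

theorem regular_sequence_SR_ring:
  fixes \<Delta> :: "('n::finite) set set"
  assumes down: "\<forall>\<sigma>\<in>\<Delta>. \<forall>\<tau>\<subseteq>\<sigma>. \<tau> \<in> \<Delta>" and V: "\<forall>\<tau>\<in>\<Delta>. \<tau> \<subseteq> V"
    and cm: "cohen_macaulay (SR_ring V \<Delta>)"
    and F: "F \<in> \<Delta>" "length ls \<le> card F"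
    and lin: "\<forall>l\<in>set ls. linear_form V l"
    and param: "\<And>\<tau> j. \<tau> \<in> \<Delta> \<Longrightarrow> j \<in> \<tau> \<Longrightarrow>
      \<exists>f. f j = 1 \<and> (\<forall>t\<in>\<tau> - {j}. f t = 0) \<and> (\<Sum>t\<in>UNIV. Const (f t) * Var t) \<in> ideal_span (set ls)"
  shows "regular_sequence (SR_ring V \<Delta>) (map (SR_class V \<Delta>) ls)"
proof -
  let ?R = "SR_ring V \<Delta>" and ?\<phi> = "\<lambda>p. SR_class V \<Delta> (poly_proj V p)"
  let ?J = "nonface_ideal \<Delta>" and ?P = "\<lambda>G. nonface_ideal (Pow G)"
  interpret ring_presentation ?R ?\<phi> by (rule SR_ring_presentation(1)[OF down V])
  have ker: "hom_kernel = ?J" by (rule SR_ring_presentation(2)[OF down V])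
  have J: "is_ideal ?J" by (rule is_ideal_nonface_ideal[OF down])
  have P: "is_ideal (?P G)" for G :: "'n set" by (rule is_ideal_nonface_ideal) auto
  have P1: "1 \<notin> ?P G" for G :: "'n set" by (simp add: nonface_ideal_def)
  have JP: "?J \<subseteq> ?P G" if "G \<subseteq> F" for G
    using F(1) down that by (auto simp: nonface_ideal_def)
  let ?m = "?\<phi> ` ?P {}"
  have max: "maximalideal ?m ?R"
  proof (rule maximalideal_image[OF P _ P1])
    show "hom_kernel \<subseteq> ?P {}" unfolding ker by (rule JP) simp
    fix x :: "'n mpol" assume "x \<notin> ?P {}"
    then have x: "Poly_Mapping.lookup x 0 \<noteq> 0" by (simp add: nonface_ideal_empty)
    have "x * Const (1 / Poly_Mapping.lookup x 0) - 1 \<in> ?P {}"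
      using x by (simp add: nonface_ideal_empty lookup_minus mult.commute[of x] lookup_Const_mult)
    then show "\<exists>y. x * y - 1 \<in> ?P {}" by blast
  qed
  have "enat (length ls) \<le> prime_height ?R ?m"
  proof -
    define r where "r = length ls"
    obtain F' where "F' \<subseteq> F" "card F' = r" using F(2) r_def obtain_subset_with_card_n by metis
    then obtain xs where xs: "set xs \<subseteq> F" "distinct xs" "length xs = r"
      by (metis finite_distinct_list distinct_card finite)
    \<comment> \<open>\<open>Q 0\<close> belongs to the face formed by all of \<open>xs\<close>.
      Each step removes the last remaining vertex, so the primes grow until \<open>Q r\<close> is
      the irrelevant ideal; the removed variable witnesses strictness.\<close>
    define Q where "Q i = ?\<phi> ` ?P (set (take (r - i) xs))" for i
    have sub: "set (take i xs) \<subseteq> F" for i using xs(1) set_take_subset by fast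
    have KP: "hom_kernel \<subseteq> ?P (set (take i xs))" for i unfolding ker by (rule JP[OF sub])
    have "primeideal (Q i) ?R" for i
      unfolding Q_def
      by (rule primeideal_image[OF P KP P1 primeideal_nonface_ideal])
    moreover have "Q i \<subset> Q (Suc i)" if i: "i < r" for i
    proof
      have "set (take (r - Suc i) xs) \<subseteq> set (take (r - i) xs)"
        by (rule set_take_subset_set_take) simp
      then show "Q i \<subseteq> Q (Suc i)"
        unfolding Q_def by (intro image_mono) (auto simp: nonface_ideal_def)
      let ?k = "r - Suc i"
      have k: "r - i = Suc ?k" "?k < length xs" using i xs by auto
      have Var: "Var j \<in> ?P G \<longleftrightarrow> j \<notin> G" for j :: 'n and G
        by (auto simp: nonface_ideal_def Var_def monom_def)
      have "xs ! ?k \<notin> set (take ?k xs)"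
        using xs(2) k(2) by (auto simp: in_set_conv_nth nth_eq_iff_index_eq)
      then have "?\<phi> (Var (xs ! ?k)) \<in> Q (Suc i)" unfolding Q_def by (intro imageI) (simp add: Var)
      moreover have "?\<phi> (Var (xs ! ?k)) \<notin> Q i"
        unfolding Q_def k(1) mem_image_iff[OF P KP] using k(2)
        by (simp add: Var take_Suc_conv_app_nth)
      ultimately show "Q i \<noteq> Q (Suc i)" by blast
    qed
    moreover have "Q r = ?m" by (simp add: Q_def)
    ultimately show ?thesis
      unfolding prime_height_def r_def[symmetric] by (intro Sup_upper) blast
  qed
  also have "\<dots> = ideal_depth ?R ?m" using cm max by (simp add: cohen_macaulay_def)
  finally have depth: "enat (length ls) \<le> ideal_depth ?R ?m" .
  obtain fs where fs: "regular_mod ?J fs" "set fs \<subseteq> ?P {}" "length ls \<le> length fs"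
  proof (cases "ls = []")
    \<comment> \<open>\<open>ideal_depth_ge\<close> asks for a positive length; here the empty list
      does.\<close>
    case True
    then show ?thesis using that[of "[]"] by (simp add: regular_mod_def)
  next
    case False
    then obtain gs where gs: "regular_sequence ?R gs" "set gs \<subseteq> ?m" "length ls \<le> length gs"
      using ideal_depth_ge[OF depth] by auto
    \<comment> \<open>The lifts are chosen inside the irrelevant ideal, so they have no constant
      term and \<open>variables_nilpotent\<close> applies to them.\<close>
    define fs where "fs = map (inv_into (?P {}) ?\<phi>) gs"
    have "map ?\<phi> fs = gs"
      unfolding fs_def map_map
    proof (rule map_idI)
      fix g assume "g \<in> set gs"
      then have "g \<in> ?m" using gs(2) by (rule rev_subsetD)
      then show "(?\<phi> \<circ> inv_into (?P {}) ?\<phi>) g = g" unfolding comp_def by (rule f_inv_into_f)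
    qed
    then have "regular_mod ?J fs" using gs(1) regular_sequence_map_iff ker by metis
    moreover have "set fs \<subseteq> ?P {}"
      unfolding fs_def using gs(2) inv_into_into[of _ ?\<phi> "?P {}"] by auto
    ultimately show ?thesis using that gs(3) by (simp add: fs_def)
  qed
  have "regular_mod ?J ls"
  proof (rule regular_mod_parameters[OF J _ _ fs(1,3)])
    show "trunc N p \<in> ?J" if "p \<in> ?J" for N p
      using that by (auto simp: nonface_ideal_def keys_restrict_terms)
    show "\<forall>l\<in>set ls. linear_homogeneous l" using lin linear_form_linear_homogeneous by blast
    fix f assume "f \<in> set fs"
    then have f0: "Poly_Mapping.lookup f 0 = 0" using fs(2) by (auto simp: nonface_ideal_empty)
    have ls: "ideal_span (set ls) \<subseteq> ideal_span (?J \<union> set ls)" by (intro ideal_span_mono) auto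
    show "\<exists>N. f ^ N \<in> ideal_span (?J \<union> set ls)"
    proof (rule variables_nilpotent[OF is_ideal_span _ _ f0])
      show "?J \<subseteq> ideal_span (?J \<union> set ls)" by (auto intro: ideal_span_base)
    qed (use param ls in blast)
  qed
  moreover have "1 \<notin> ideal_span (?J \<union> set ls)"
  proof -
    have "Poly_Mapping.lookup l 0 = 0" if "l \<in> set ls" for l
    proof -
      have "linear_homogeneous l" using lin that linear_form_linear_homogeneous by blast
      then have "0 \<notin> Poly_Mapping.keys l" by (auto simp: linear_homogeneous_def expo_degree_def)
      then show ?thesis by (simp add: in_keys_iff)
    qed
    then have "ideal_span (?J \<union> set ls) \<subseteq> ?P {}"
      using JP[of "{}"] by (intro ideal_span_minimal P) (auto simp: nonface_ideal_empty)
    then show ?thesis using P1 by blast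
  qed
  ultimately have "regular_sequence ?R (map ?\<phi> ls)" by (simp add: regular_sequence_map_iff ker)
  moreover have "poly_proj V l = l" if "l \<in> set ls" for l
    using lin that linear_form_carrier carrier_mpol_ring by blast
  then have "map ?\<phi> ls = map (SR_class V \<Delta>) ls" by simp
  ultimately show ?thesis by simp
qed

section \<open>Standard pairs of initial ideals of toric ideals\<close>

text \<open>Binomials provide integral relations, so the elimination avoids division:
  \<open>y s\<close> is \<open>c\<close> times a functional dual to column \<open>s\<close>. For a
  new column \<open>j\<close>, a functional vanishing on the old columns but not on \<open>j\<close>
  is found and used to correct the old ones.\<close>

lemma integer_dual_basis:
  fixes A :: "int ^ 'n ^ 'd" and \<sigma> :: "('n::finite) set"
  assumes "\<And>u. (\<forall>i. (\<Sum>j\<in>\<sigma>. A $ i $ j * u j) = 0) \<Longrightarrow> \<forall>j\<in>\<sigma>. u j = 0"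
  shows "\<exists>c y. c \<noteq> 0 \<and>
    (\<forall>s\<in>\<sigma>. \<forall>t\<in>\<sigma>. (\<Sum>i\<in>UNIV. y s i * A $ i $ t) = (if s = t then c else (0::int)))"
proof -
  have "finite \<sigma>" by simp
  then show ?thesis using assms
  proof (induction \<sigma> rule: finite_induct)
    case empty
    show ?case by (intro exI[of _ 1]) auto
  next
    case (insert j \<sigma>)
    have "\<forall>t\<in>\<sigma>. u t = 0" if u: "\<forall>i. (\<Sum>t\<in>\<sigma>. A $ i $ t * u t) = 0" for u
    proof -
      have "(\<Sum>t\<in>insert j \<sigma>. A $ i $ t * (u(j := 0)) t) = 0" for i
      proof -
        have "(\<Sum>t\<in>insert j \<sigma>. A $ i $ t * (u(j := 0)) t) = (\<Sum>t\<in>\<sigma>. A $ i $ t * (u(j := 0)) t)"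
          using insert.hyps by simp
        also have "\<dots> = (\<Sum>t\<in>\<sigma>. A $ i $ t * u t)"
          using insert.hyps by (intro sum.cong) auto
        finally show ?thesis using u by simp
      qed
      with insert.prems[of "u(j := 0)"] insert.hyps(2) show ?thesis by (metis fun_upd_other insertCI)
    qed
    from insert.IH[OF this] obtain c y where c: "c \<noteq> 0" and y:
      "\<And>s t. s \<in> \<sigma> \<Longrightarrow> t \<in> \<sigma> \<Longrightarrow> (\<Sum>i\<in>UNIV. y s i * A $ i $ t) = (if s = t then c else (0::int))"
      by blast
    define d where "d z t = (\<Sum>i\<in>UNIV. z i * A $ i $ t)" for z t
    have d: "d (y s) t = (if s = t then c else 0)" if "s \<in> \<sigma>" "t \<in> \<sigma>" for s t
      using y that by (simp add: d_def)
    \<comment> \<open>Up to the factor \<open>c\<close>, this is column \<open>j\<close> minus its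
      component along the old columns; if it vanished, \<open>?u\<close> below would be a relation
      with the nonzero coefficient \<open>c\<close> at \<open>j\<close>.\<close>
    define b where "b i = c * A $ i $ j - (\<Sum>t\<in>\<sigma>. d (y t) j * A $ i $ t)" for i
    have "\<exists>i. b i \<noteq> 0"
    proof (rule ccontr)
      assume "\<not> ?thesis"
      then have b: "b i = 0" for i by blast
      let ?u = "\<lambda>t. if t = j then c else - d (y t) j"
      have "(\<Sum>t\<in>insert j \<sigma>. A $ i $ t * ?u t) = 0" for i
      proof -
        have "(\<Sum>t\<in>insert j \<sigma>. A $ i $ t * ?u t) = A $ i $ j * c + (\<Sum>t\<in>\<sigma>. A $ i $ t * ?u t)"
          using insert.hyps by simp
        also have "(\<Sum>t\<in>\<sigma>. A $ i $ t * ?u t) = (\<Sum>t\<in>\<sigma>. - (d (y t) j * A $ i $ t))"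
          using insert.hyps by (intro sum.cong) auto
        finally show ?thesis using b[of i] by (simp add: b_def sum_negf algebra_simps)
      qed
      with insert.prems[of ?u] c show False by auto
    qed
    then obtain i where i: "b i \<noteq> 0" by blast
    \<comment> \<open>\<open>z\<close> reads coordinate \<open>i\<close> after the same projection,
      hence kills the old columns and has the value \<open>b i\<close> on column
      \<open>j\<close>.\<close>
    define z where "z k = (if k = i then c else 0) - (\<Sum>t\<in>\<sigma>. A $ i $ t * y t k)" for k
    have dz: "d z s = c * A $ i $ s - (\<Sum>t\<in>\<sigma>. A $ i $ t * d (y t) s)" for s
    proof -
      have "d z s = (\<Sum>k\<in>UNIV. (if k = i then c else 0) * A $ k $ s)
          - (\<Sum>k\<in>UNIV. \<Sum>t\<in>\<sigma>. A $ i $ t * (y t k * A $ k $ s))"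
        by (simp add: d_def z_def left_diff_distrib sum_subtractf sum_distrib_right mult.assoc)
      also have "(\<Sum>k\<in>UNIV. (if k = i then c else 0) * A $ k $ s) = (\<Sum>k\<in>UNIV. if k = i then c * A $ k $ s else 0)"
        by (intro sum.cong) auto
      also have "\<dots> = c * A $ i $ s" by simp
      also have "(\<Sum>k\<in>UNIV. \<Sum>t\<in>\<sigma>. A $ i $ t * (y t k * A $ k $ s)) = (\<Sum>t\<in>\<sigma>. A $ i $ t * d (y t) s)"
        by (subst sum.swap) (simp add: d_def sum_distrib_left)
      finally show ?thesis .
    qed
    have z0: "d z s = 0" if "s \<in> \<sigma>" for s
    proof -
      have "(\<Sum>t\<in>\<sigma>. A $ i $ t * d (y t) s) = (\<Sum>t\<in>\<sigma>. if t = s then A $ i $ t * c else 0)"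
        using that by (intro sum.cong) (auto simp: d)
      also have "\<dots> = A $ i $ s * c" using that by simp
      finally show ?thesis by (simp add: dz)
    qed
    have zj: "d z j = b i" by (simp add: dz b_def mult.commute)
    have lin: "d (\<lambda>k. p * f k - q * g k) t = p * d f t - q * d g t" for p q f g t
      by (simp add: d_def sum_distrib_left sum_subtractf left_diff_distrib mult.assoc)
    have scale: "d (\<lambda>k. p * f k) t = p * d f t" for p f t
      by (simp add: d_def sum_distrib_left mult.assoc)
    \<comment> \<open>The factors \<open>c\<close> and \<open>b i\<close> give all functionals the
      common diagonal value \<open>c * b i\<close>; the multiple of \<open>z\<close> cancels the
      value of the old functional on column \<open>j\<close>.\<close>
    define y' where "y' s = (if s = j then (\<lambda>k. c * z k) else (\<lambda>k. b i * y s k - d (y s) j * z k))" for s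
    have "d (y' s) t = (if s = t then c * b i else 0)" if "s \<in> insert j \<sigma>" "t \<in> insert j \<sigma>" for s t
      using that insert.hyps(2) by (auto simp: y'_def lin scale z0 zj d)
    moreover have "c * b i \<noteq> 0" using c i by simp
    ultimately show ?case unfolding d_def by blast
  qed
qed

section \<open>Independence of the columns over a standard pair\<close>

lemma monomial_ideal_monom:
  assumes M: "monomial_ideal M" and p: "p \<in> M" "u \<in> Poly_Mapping.keys p"
  shows "monom u \<in> M"
proof -
  obtain U where M: "M = ideal_span (monom ` U)"
    using M by (auto simp: monomial_ideal_def genideal_mpol_ring_UNIV)
  let ?K = "{p. \<forall>u\<in>Poly_Mapping.keys p. monom u \<in> M}"
  have "is_ideal ?K"
  proof (rule is_idealI)
    show "x + y \<in> ?K" if "x \<in> ?K" "y \<in> ?K" for x y using that keys_add[of x y] by auto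
    show "c * x \<in> ?K" if "x \<in> ?K" for c x
    proof -
      have "monom u \<in> M" if u: "u \<in> Poly_Mapping.keys (c * x)" for u
      proof -
        obtain a b where ab: "u = a + b" "b \<in> Poly_Mapping.keys x"
          using keys_mult[of c x] u by auto
        then have "monom b \<in> M" using \<open>x \<in> ?K\<close> by blast
        then have "monom a * monom b \<in> M" unfolding M by (rule is_ideal_mult[OF is_ideal_span])
        then show ?thesis using ab by (simp add: monom_def mult_single)
      qed
      then show ?thesis by blast
    qed
  qed simp
  moreover have "monom ` U \<subseteq> ?K" by (auto simp: M monom_def intro: ideal_span_base)
  ultimately have "M \<subseteq> ?K" unfolding M by (intro ideal_span_minimal) (simp_all add: M)
  then show ?thesis using p by blast
qed

lemma keys_initial_form:
  "Poly_Mapping.keys (initial_form w p) =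
     {u \<in> Poly_Mapping.keys p. \<forall>u'\<in>Poly_Mapping.keys p. weight w u' \<le> weight w u}"
proof -
  have "initial_form w p = restrict_terms (\<lambda>u. \<forall>u'\<in>Poly_Mapping.keys p. weight w u' \<le> weight w u) p"
    by (rule poly_mapping_eqI)
       (auto simp: initial_form_def lookup_sum lookup_single when_def lookup_restrict_terms in_keys_iff)
  then show ?thesis by (simp add: keys_restrict_terms)
qed

lemma standard_pair_independent:
  fixes A :: "int ^ ('n::finite) ^ 'd"
  assumes gen: "generic_weight A w"
    and sp: "(a, \<sigma>) \<in> standard_pairs (initial_ideal w (toric_ideal A))"
    and rel: "\<forall>i. (\<Sum>j\<in>\<sigma>. A $ i $ j * u j) = 0"
  shows "\<forall>j\<in>\<sigma>. u j = 0"
proof (rule ccontr)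
  assume "\<not> ?thesis"
  then obtain j0 where j0: "j0 \<in> \<sigma>" "u j0 \<noteq> 0" by blast
  let ?M = "initial_ideal w (toric_ideal A)"
  define e where "e b = (\<Sum>j\<in>\<sigma>. Poly_Mapping.single j (b j))" for b :: "'n \<Rightarrow> nat"
  have lookup_e: "Poly_Mapping.lookup (e b) j = (if j \<in> \<sigma> then b j else 0)" for b j
    by (simp add: e_def lookup_sum lookup_single when_def)
  \<comment> \<open>The positive and negative parts of the relation are the two exponents of the
    binomial.\<close>
  let ?p = "e (\<lambda>j. nat (u j))" and ?q = "e (\<lambda>j. nat (- u j))"
  have ne: "?p \<noteq> ?q"
  proof
    assume "?p = ?q"
    then have "Poly_Mapping.lookup ?p j0 = Poly_Mapping.lookup ?q j0" by simp
    then show False using j0 by (simp add: lookup_e)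
  qed
  let ?f = "monom ?p - monom ?q"
  have keys: "Poly_Mapping.keys ?f = {?p, ?q}"
    using ne by (auto simp: monom_def in_keys_iff lookup_minus lookup_single when_def split: if_splits)
  have "(\<Sum>j\<in>UNIV. A $ i $ j * int (Poly_Mapping.lookup ?p j))
      = (\<Sum>j\<in>UNIV. A $ i $ j * int (Poly_Mapping.lookup ?q j))" for i
  proof -
    have "(\<Sum>j\<in>UNIV. A $ i $ j * int (Poly_Mapping.lookup ?p j))
        - (\<Sum>j\<in>UNIV. A $ i $ j * int (Poly_Mapping.lookup ?q j))
        = (\<Sum>j\<in>UNIV. if j \<in> \<sigma> then A $ i $ j * u j else 0)"
      unfolding sum_subtractf[symmetric] by (intro sum.cong) (auto simp: lookup_e algebra_simps)
    also have "\<dots> = (\<Sum>j\<in>\<sigma>. A $ i $ j * u j)" by (simp add: sum.If_cases)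
    finally show ?thesis using rel by simp
  qed
  then have "?f \<in> toric_ideal A"
    unfolding toric_ideal_def genideal_mpol_ring_UNIV by (intro ideal_span_base) blast
  then have init: "initial_form w ?f \<in> ?M"
    unfolding initial_ideal_def genideal_mpol_ring_UNIV by (intro ideal_span_base) blast
  \<comment> \<open>At least one term has maximal weight. In a tie the initial form is the whole
    binomial, but a monomial ideal contains each of its terms.\<close>
  have "?p \<in> Poly_Mapping.keys (initial_form w ?f) \<or> ?q \<in> Poly_Mapping.keys (initial_form w ?f)"
    unfolding keys_initial_form keys by auto
  then obtain b where "monom (e b) \<in> ?M"
    using monomial_ideal_monom[OF gen[unfolded generic_weight_def] init] by blast
  then have "monom a * (\<Prod>j\<in>\<sigma>. Var j ^ b j) \<in> ?M"
    unfolding prod_Var e_def[symmetric] initial_ideal_def genideal_mpol_ring_UNIV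
    by (rule is_ideal_mult[OF is_ideal_span])
  then show False using sp by (auto simp: standard_pairs_def)
qed

text \<open>Only the constant terms of the coefficients matter for a linear element of an ideal
  generated by linear forms.\<close>

lemma linear_in_ideal_span:
  fixes G :: "('n::finite) mpol set"
  assumes G: "finite G" "\<forall>g\<in>G. linear_homogeneous g"
    and E: "linear_homogeneous E" "E \<in> ideal_span G"
  shows "\<exists>e. E = (\<Sum>g\<in>G. Const (e g) * g)"
proof -
  obtain r where r: "E = (\<Sum>g\<in>G. r g * g)"
    using E(2) module.span_finite[OF module_times G(1)] by auto
  have deg0: "expo_degree u = 0 \<longleftrightarrow> u = 0" for u :: "'n expo"
    by (auto simp: expo_degree_def intro!: poly_mapping_eqI)
  have t1: "trunc 1 p = Const (Poly_Mapping.lookup p 0)" for p :: "'n mpol"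
    by (rule poly_mapping_eqI)
       (auto simp: lookup_restrict_terms Const_def lookup_single when_def deg0)
  have sum: "trunc 2 (\<Sum>g\<in>H. r g * g) = (\<Sum>g\<in>H. trunc 2 (r g * g))" for H
    by (induction H rule: infinite_finite_induct) (simp_all add: restrict_terms_zero restrict_terms_add)
  have "E = trunc 2 E"
    using E(1) by (intro restrict_terms_ident[symmetric]) (simp add: linear_homogeneous_def)
  also have "\<dots> = (\<Sum>g\<in>G. trunc 2 (r g * g))" by (simp add: r sum)
  also have "\<dots> = (\<Sum>g\<in>G. Const (Poly_Mapping.lookup (r g) 0) * g)"
  proof (intro sum.cong refl)
    fix g assume "g \<in> G"
    then show "trunc 2 (r g * g) = Const (Poly_Mapping.lookup (r g) 0) * g"
      using trunc_linear_mult[of g 1 "r g", unfolded t1] G(2) by (simp add: mult.commute numeral_2_eq_2)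
  qed
  finally show ?thesis by (rule exI[of _ "\<lambda>g. Poly_Mapping.lookup (r g) 0"])
qed

text \<open>The rows of \<open>A\<close>, combined with coefficients \<open>y i / c\<close>, give
  the required form; at parameter 0 the Euler generators are exactly the linear forms of these
  rows.\<close>

lemma euler_ideal_linear_forms:
  fixes A :: "int ^ ('n::finite) ^ 'd"
  assumes "c \<noteq> 0" "\<And>t. t \<in> \<sigma> \<Longrightarrow> (\<Sum>i\<in>UNIV. y i * A $ i $ t) = (if t = j then c else 0)"
    and "j \<in> \<sigma>"
  shows "\<exists>f. f j = 1 \<and> (\<forall>t\<in>\<sigma> - {j}. f t = 0) \<and> (\<Sum>t\<in>UNIV. Const (f t) * Var t) \<in> euler_ideal A 0"
proof -
  define f :: "'n \<Rightarrow> complex" where "f t = (\<Sum>i\<in>UNIV. of_int (y i) / of_int c * of_int (A $ i $ t))" for t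
  have f: "f t = of_int (\<Sum>i\<in>UNIV. y i * A $ i $ t) / of_int c" for t
    by (simp add: f_def sum_divide_distrib)
  have "(\<Sum>t\<in>UNIV. Const (f t) * Var t)
      = (\<Sum>t\<in>UNIV. \<Sum>i\<in>UNIV. Const (of_int (y i) / of_int c) * (Const (of_int (A $ i $ t)) * Var t))"
    by (simp only: f_def Const_sum Const_mult sum_distrib_right mult.assoc)
  also have "\<dots> = (\<Sum>i\<in>UNIV. Const (of_int (y i) / of_int c) *
      (\<Sum>t\<in>UNIV. Const (of_int (A $ i $ t)) * Var t))"
    by (subst sum.swap) (simp add: sum_distrib_left)
  also have "\<dots> \<in> euler_ideal A 0"
    unfolding euler_ideal_def genideal_mpol_ring_UNIV
    by (intro is_ideal_sum[OF is_ideal_span] is_ideal_mult[OF is_ideal_span] ideal_span_base) auto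
  finally have "(\<Sum>t\<in>UNIV. Const (f t) * Var t) \<in> euler_ideal A 0" .
  moreover have "f j = 1" "\<forall>t\<in>\<sigma> - {j}. f t = 0" using assms by (auto simp: f)
  ultimately show ?thesis by blast
qed

text \<open>The variable \<open>idx p\<close> occurs in a single generator, with coefficient 1. A
  constant combination of the generators that is free of the variables in \<open>I0\<close>
  therefore cannot use that generator.\<close>

lemma linear_form_eliminate:
  fixes f :: "'n::finite \<Rightarrow> complex"
  assumes idx: "bij_betw idx P I0" and "finite P" "finite Q" and V: "V \<inter> I0 = {}"
    and L: "\<forall>p\<in>P. linear_form V (L p)" and l: "\<forall>q\<in>Q. linear_form V (l q)"
    and E: "(\<Sum>t\<in>UNIV. Const (f t) * Var t) \<in> ideal_span ((\<lambda>p. Var (idx p) - L p) ` P \<union> l ` Q)"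
    and f: "\<forall>t\<in>I0. f t = 0"
  shows "(\<Sum>t\<in>UNIV. Const (f t) * Var t) \<in> ideal_span (l ` Q)"
proof -
  let ?x = "\<lambda>j. Poly_Mapping.single j (Suc 0)"
  let ?E = "\<Sum>t\<in>UNIV. Const (f t) * Var t"
  let ?G1 = "(\<lambda>p. Var (idx p) - L p) ` P" and ?G = "(\<lambda>p. Var (idx p) - L p) ` P \<union> l ` Q"
  have inj: "?x i = ?x j \<longleftrightarrow> i = j" for i j :: 'n
    by (metis lookup_single_eq lookup_single_not_eq nat.distinct(1))
  have van: "Poly_Mapping.lookup g (?x i) = 0" if g: "linear_form V g" and i: "i \<in> I0" for g i
  proof (rule ccontr)
    assume "Poly_Mapping.lookup g (?x i) \<noteq> 0"
    then obtain j where "j \<in> V" "?x i = ?x j"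
      using linear_form_keys[OF g, of "?x i"] by (auto simp: in_keys_iff)
    then show False using inj i V by auto
  qed
  have lookE: "Poly_Mapping.lookup ?E (?x i) = f i" for i
    by (simp add: lookup_sum lookup_Const_mult lookup_Var inj if_distrib[of "(*) _"] cong: if_cong)
  have linE: "linear_homogeneous ?E"
    by (rule linear_form_linear_homogeneous[of UNIV]) (auto simp: linear_form_def)
  have linG: "\<forall>g\<in>?G. linear_homogeneous g"
  proof -
    have "linear_homogeneous (Var (idx p) - L p)" if "p \<in> P" for p
    proof -
      have "linear_homogeneous (L p)" using L that linear_form_linear_homogeneous by blast
      then show ?thesis
        using keys_diff[of "Var (idx p)" "L p"]
        by (auto simp: linear_homogeneous_def Var_def monom_def expo_degree_single)
    qed
    then show ?thesis using l linear_form_linear_homogeneous by blast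
  qed
  obtain e where e: "?E = (\<Sum>g\<in>?G. Const (e g) * g)"
    using linear_in_ideal_span[OF _ linG linE E] \<open>finite P\<close> \<open>finite Q\<close> by blast
  have zero: "e (Var (idx p) - L p) = 0" if p: "p \<in> P" for p
  proof -
    let ?g = "Var (idx p) - L p" and ?i = "idx p"
    have i: "?i \<in> I0" using idx p by (auto simp: bij_betw_def)
    \<comment> \<open>\<open>van\<close> excludes the variables of \<open>I0\<close> from every
      \<open>L p\<close> and \<open>l q\<close>; injectivity of \<open>idx\<close> separates the
      generators of the first kind.\<close>
    have "Poly_Mapping.lookup g (?x ?i) = (if g = ?g then 1 else 0)" if "g \<in> ?G" for g
    proof -
      have one: "Poly_Mapping.lookup ?g (?x ?i) = 1"
        using L p i by (simp add: lookup_minus lookup_Var van)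
      have "Poly_Mapping.lookup g (?x ?i) = 0" if "g \<noteq> ?g"
      proof (cases "g \<in> l ` Q")
        case True
        then show ?thesis using l i van by blast
      next
        case False
        then obtain p' where p': "p' \<in> P" "g = Var (idx p') - L p'" using \<open>g \<in> ?G\<close> by blast
        then have "idx p' \<noteq> idx p" using that idx p by (auto simp: bij_betw_def inj_on_def)
        then show ?thesis using p' L i by (simp add: lookup_minus lookup_Var van inj)
      qed
      then show ?thesis using one by auto
    qed
    then have "(\<Sum>g\<in>?G. e g * Poly_Mapping.lookup g (?x ?i)) = (\<Sum>g\<in>?G. if g = ?g then e g else 0)"
      by (intro sum.cong) auto
    also have "\<dots> = e ?g" using p \<open>finite P\<close> \<open>finite Q\<close> by (subst sum.delta) auto
    finally have "e ?g = Poly_Mapping.lookup ?E (?x ?i)"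
      by (simp add: e lookup_sum lookup_Const_mult)
    then show ?thesis using f i by (simp add: lookE)
  qed
  have "Const (e g) * g \<in> ideal_span (l ` Q)" if "g \<in> ?G" for g
  proof (cases "g \<in> ?G1")
    case True
    then have "e g = 0" using zero by auto
    then show ?thesis by (simp add: is_ideal_0[OF is_ideal_span])
  next
    case False
    then show ?thesis
      using that by (intro is_ideal_mult[OF is_ideal_span] ideal_span_base) auto
  qed
  then show ?thesis unfolding e by (intro is_ideal_sum[OF is_ideal_span])
qed

theorem theorem5p1:
  fixes A :: "int ^ 'n ^ 'd"
    and \<beta> :: "complex ^ 'd"
    and w :: "real ^ 'n"
    and v :: "complex ^ 'n"
    and I0 V :: "'n set"
    and k :: nat
    and idx :: "nat \<Rightarrow> 'n"
    and L l :: "nat \<Rightarrow> 'n mpol"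
  assumes "rank (map_matrix rat_of_int A) = CARD('d)"
    and "homogeneous_config A"
    and "generic_weight A w"
    and "fake_exponent A \<beta> w v"
    and "I0 = nsupp v"
    and "k = card I0"
    and "bij_betw idx {1..k} I0"
    and "V = UNIV - I0"
    and "\<forall>p\<in>{1..k}. linear_form V (L p)"
    and "\<forall>q\<in>{1..CARD('d) - k}. linear_form V (l q)"
    and "euler_ideal A 0 = Idl\<^bsub>mpol_ring UNIV\<^esub>
           ((\<lambda>p. Var (idx p) - L p) ` {1..k} \<union> l ` {1..CARD('d) - k})"
    and "\<exists>(a, \<sigma>)\<in>standard_pairs_at A w v. card \<sigma> = CARD('d)"
    and "cohen_macaulay (SR_ring V (link_complex A w v))"
  shows "regular_sequence (SR_ring V (link_complex A w v))
           (map (\<lambda>q. SR_class V (link_complex A w v) (l q)) [1..<Suc (CARD('d) - k)])"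
proof -
  let ?\<Delta> = "link_complex A w v" and ?ls = "map l [1..<Suc (CARD('d) - k)]"
  \<comment> \<open>Outside \<open>\<sigma>\<close> the entries of \<open>v\<close> are natural
    numbers, so the negative integers among them sit inside \<open>\<sigma>\<close>. Hence removing
    \<open>I0\<close> from \<open>\<sigma>\<close> leaves a face of the link.\<close>
  have I0: "I0 \<subseteq> \<sigma>" if sp: "(a, \<sigma>) \<in> standard_pairs_at A w v" for a \<sigma>
  proof
    fix j assume "j \<in> I0"
    then obtain m :: int where m: "m < 0" "v $ j = of_int m" using assms(5) by (auto simp: nsupp_def)
    show "j \<in> \<sigma>"
    proof (rule ccontr)
      assume "j \<notin> \<sigma>"
      then have "v $ j = of_nat (Poly_Mapping.lookup a j)" using sp by (auto simp: standard_pairs_at_def)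
      then have "(of_int m :: complex) = of_int (int (Poly_Mapping.lookup a j))" using m by simp
      then have "m = int (Poly_Mapping.lookup a j)" by (simp only: of_int_eq_iff)
      then show False using m by simp
    qed
  qed
  have link: "\<tau> \<in> ?\<Delta> \<longleftrightarrow> \<tau> \<inter> I0 = {} \<and> (\<exists>a \<sigma>. (a, \<sigma>) \<in> standard_pairs_at A w v \<and> \<tau> \<union> I0 \<subseteq> \<sigma>)" for \<tau>
  proof -
    have "\<tau> \<in> Delta_complex A w v \<longleftrightarrow> (\<exists>a \<sigma>. (a, \<sigma>) \<in> standard_pairs_at A w v \<and> \<tau> \<subseteq> \<sigma>)" for \<tau>
      unfolding Delta_complex_def by blast
    then show ?thesis unfolding link_complex_def assms(5) by blast
  qed
  obtain a \<sigma> where \<sigma>: "(a, \<sigma>) \<in> standard_pairs_at A w v" "card \<sigma> = CARD('d)"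
    using assms(12) by blast
  have "regular_sequence (SR_ring V ?\<Delta>) (map (SR_class V ?\<Delta>) ?ls)"
  proof (rule regular_sequence_SR_ring[OF _ _ assms(13)])
    show "\<forall>\<sigma>\<in>?\<Delta>. \<forall>\<tau>\<subseteq>\<sigma>. \<tau> \<in> ?\<Delta>" unfolding link Ball_def by blast
    show "\<forall>\<tau>\<in>?\<Delta>. \<tau> \<subseteq> V" using assms(8) by (auto simp: link)
    show "\<sigma> - I0 \<in> ?\<Delta>" unfolding link using \<sigma>(1) I0[OF \<sigma>(1)] by blast
    \<comment> \<open>Since \<open>I0\<close> lies in a set of \<open>d\<close> elements,
      \<open>k \<le> d\<close> and the subtraction of natural numbers is a true difference.\<close>
    have "card (\<sigma> - I0) = CARD('d) - k"
      using I0[OF \<sigma>(1)] \<sigma>(2) assms(6) by (simp add: card_Diff_subset finite_subset)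
    then show "length ?ls \<le> card (\<sigma> - I0)" by (simp only: length_map length_upt)
    show "\<forall>l\<in>set ?ls. linear_form V l"
      using assms(10) by (simp only: set_map set_upt atLeastLessThanSuc_atLeastAtMost) auto
    fix \<tau> j assume \<tau>: "\<tau> \<in> ?\<Delta>" "j \<in> \<tau>"
    then obtain b \<rho> where \<rho>: "(b, \<rho>) \<in> standard_pairs_at A w v" "\<tau> \<union> I0 \<subseteq> \<rho>" by (auto simp: link)
    have "(b, \<rho>) \<in> standard_pairs (initial_ideal w (toric_ideal A))"
      using \<rho>(1) by (simp add: standard_pairs_at_def)
    from integer_dual_basis[OF standard_pair_independent[OF assms(3) this]]
    obtain c y where c: "c \<noteq> 0" and
      y: "\<And>s t. s \<in> \<rho> \<Longrightarrow> t \<in> \<rho> \<Longrightarrow> (\<Sum>i\<in>UNIV. y s i * A $ i $ t) = (if s = t then c else 0)"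
      by blast
    have j: "j \<in> \<rho>" "j \<notin> I0" using \<tau> \<rho>(2) by (auto simp: link)
    have "(\<Sum>i\<in>UNIV. y j i * A $ i $ t) = (if t = j then c else 0)" if "t \<in> \<rho>" for t
      using y[OF j(1) that] by auto
    \<comment> \<open>Duality is taken on all of \<open>\<rho>\<close>, not merely on
      \<open>\<tau>\<close>: the form then vanishes on \<open>I0\<close> as well, as the elimination
      requires.\<close>
    from euler_ideal_linear_forms[OF c this j(1)] obtain f where
      f: "f j = 1" "\<forall>t\<in>\<rho> - {j}. f t = 0" "(\<Sum>t\<in>UNIV. Const (f t) * Var t) \<in> euler_ideal A 0"
      by blast
    have "(\<Sum>t\<in>UNIV. Const (f t) * Var t) \<in> ideal_span (l ` {1..CARD('d) - k})"
    proof (rule linear_form_eliminate[OF assms(7) _ _ _ assms(9,10)])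
      show "V \<inter> I0 = {}" using assms(8) by auto
      show "(\<Sum>t\<in>UNIV. Const (f t) * Var t)
          \<in> ideal_span ((\<lambda>p. Var (idx p) - L p) ` {1..k} \<union> l ` {1..CARD('d) - k})"
        using f(3) assms(11) by (simp add: genideal_mpol_ring_UNIV)
      show "\<forall>t\<in>I0. f t = 0" using f(2) \<rho>(2) j(2) by blast
    qed auto
    moreover have "set ?ls = l ` {1..CARD('d) - k}"
      by (simp only: set_map set_upt atLeastLessThanSuc_atLeastAtMost)
    ultimately show "\<exists>f. f j = 1 \<and> (\<forall>t\<in>\<tau> - {j}. f t = 0) \<and>
        (\<Sum>t\<in>UNIV. Const (f t) * Var t) \<in> ideal_span (set ?ls)"
      using f(1,2) \<rho>(2) by (intro exI[of _ f]) auto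
  qed
  then show ?thesis by (simp only: map_map comp_def)
qed

end
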